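(* Let $T$ be a tree of order $n$ and diameter $4$, and let $P_n$ be the path on $n$ vertices. Then $$LE(P_n)\le LE(T).$$
   Context: For a simple graph $G$ with $n$ vertices and $m$ edges, let $L(G)=D(G)-A(G)$ be its Laplacian matrix ($D(G)$ the diagonal matrix of vertex degrees, $A(G)$ the adjacency matrix), with eigenvalues $\mu_1(G)\ge\mu_2(G)\ge\dots\ge\mu_n(G)=0$ counted with multiplicity. The average degree is $\overline{d}(G)=\frac{2m}{n}$. The Laplacian energy is $LE(G)=\sum_{i=1}^{n}\left|\mu_i(G)-\overline{d}(G)\right|$. *)

theory Defs
  imports
    "Graph_Theory.Graph_Theory"
    "Jordan_Normal_Form.Char_Poly"
begin

text \<open>
  A finite simple graph is a \<^locale>\<open>pair_graph\<close>: a finite vertex set with a symmetric, irreflexive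
  set of arcs, in which the edge \<open>uv\<close> is represented by the two arcs \<open>(u, v)\<close> and \<open>(v, u)\<close>.
\<close>

definition edge_set :: "'a pair_pre_digraph \<Rightarrow> 'a set set" where
  "edge_set G = {{u, v} |u v. (u, v) \<in> parcs G}"

text \<open>
  The library predicate \<^const>\<open>tree\<close> cannot be used for symmetric digraphs: \<^const>\<open>pre_digraph.cycle\<close>
  counts the closed walk \<open>u, v, u\<close> along a single edge, so no graph with an edge would be a tree.
  The cycles of a simple graph are those of length at least 3.
\<close>

definition tree_graph :: "'a pair_pre_digraph \<Rightarrow> bool" where
  "tree_graph G \<longleftrightarrow> pair_graph G \<and> Digraph_Component.connected (with_proj G) \<and>
     \<not> (\<exists>p. pre_digraph.cycle (with_proj G) p \<and> 3 \<le> length p)"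

text \<open>Distance is the least cost of a walk when every arc has weight 1.\<close>

definition graph_dist :: "'a pair_pre_digraph \<Rightarrow> 'a \<Rightarrow> 'a \<Rightarrow> ereal" where
  "graph_dist G u v = wf_digraph.\<mu> (with_proj G) (\<lambda>_. 1) u v"

definition graph_diameter :: "'a pair_pre_digraph \<Rightarrow> ereal" where
  "graph_diameter G = (SUP u\<in>pverts G. SUP v\<in>pverts G. graph_dist G u v)"

definition path_graph :: "nat \<Rightarrow> nat pair_pre_digraph" where
  "path_graph n = \<lparr> pverts = {0..<n},
     parcs = {(i, j). i < n \<and> j < n \<and> (j = Suc i \<or> i = Suc j)} \<rparr>"

text \<open>In the following, \<open>xs\<close> is an enumeration of the vertices; it fixes the order of the rows.\<close>

definition adjacency_mat :: "'a pair_pre_digraph \<Rightarrow> 'a list \<Rightarrow> real mat" where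
  "adjacency_mat G xs = mat (length xs) (length xs)
     (\<lambda>(i, j). if (xs ! i, xs ! j) \<in> parcs G then 1 else 0)"

definition degree_mat :: "'a pair_pre_digraph \<Rightarrow> 'a list \<Rightarrow> real mat" where
  "degree_mat G xs = mat (length xs) (length xs)
     (\<lambda>(i, j). if i = j then real (out_degree (with_proj G) (xs ! i)) else 0)"

definition laplacian_mat :: "'a pair_pre_digraph \<Rightarrow> 'a list \<Rightarrow> real mat" where
  "laplacian_mat G xs = degree_mat G xs - adjacency_mat G xs"

definition vertex_list :: "'a pair_pre_digraph \<Rightarrow> 'a list" where
  "vertex_list G = (SOME xs. distinct xs \<and> set xs = pverts G)"

text \<open>
  The multiset of eigenvalues, with algebraic multiplicity. By \<open>laplacian_spectrum_eq\<close> below it does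
  not depend on the enumeration, and by \<open>size_laplacian_spectrum\<close> taking only the real roots of the
  characteristic polynomial loses nothing.
\<close>

definition laplacian_spectrum :: "'a pair_pre_digraph \<Rightarrow> real multiset" where
  "laplacian_spectrum G = proots (char_poly (laplacian_mat G (vertex_list G)))"

definition average_degree :: "'a pair_pre_digraph \<Rightarrow> real" where
  "average_degree G = 2 * real (card (edge_set G)) / real (card (pverts G))"

definition laplacian_energy :: "'a pair_pre_digraph \<Rightarrow> real" where
  "laplacian_energy G = (\<Sum>\<mu>\<in>#laplacian_spectrum G. \<bar>\<mu> - average_degree G\<bar>)"


lemma vertex_list:
  assumes "finite (pverts G)"
  shows "distinct (vertex_list G)" "set (vertex_list G) = pverts G"
proof -
  have "\<exists>xs. distinct xs \<and> set xs = pverts G"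
    using finite_distinct_list[OF assms] by blast
  from someI_ex[OF this] show "distinct (vertex_list G)" "set (vertex_list G) = pverts G"
    unfolding vertex_list_def by auto
qed

lemma laplacian_mat_carrier [simp]: "laplacian_mat G xs \<in> carrier_mat (length xs) (length xs)"
  unfolding laplacian_mat_def degree_mat_def adjacency_mat_def by auto

lemma laplacian_mat_index:
  assumes "i < length xs" "j < length xs"
  shows "laplacian_mat G xs $$ (i, j) =
    (if i = j then real (out_degree (with_proj G) (xs ! i)) else 0) -
    (if (xs ! i, xs ! j) \<in> parcs G then 1 else 0)"
  using assms unfolding laplacian_mat_def degree_mat_def adjacency_mat_def by auto

lemma similar_mat_reindex:
  fixes A B :: "real mat"
  assumes A: "A \<in> carrier_mat n n" and B: "B \<in> carrier_mat n n"
    and f: "bij_betw f {0..<n} {0..<n}"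
    and AB: "\<And>i j. i < n \<Longrightarrow> j < n \<Longrightarrow> A $$ (i, j) = B $$ (f i, f j)"
  shows "similar_mat A B"
proof (rule similar_matI)
  define P :: "real mat" where "P = mat n n (\<lambda>(i, k). if k = f i then 1 else 0)"
  define Q :: "real mat" where "Q = mat n n (\<lambda>(k, j). if k = f j then 1 else 0)"
  have fl: "f i < n" if "i < n" for i using f that by (auto dest: bij_betwE)
  have inj: "f i = f j \<longleftrightarrow> i = j" if "i < n" "j < n" for i j
    using f that by (auto simp: bij_betw_def inj_on_def)
  show "{A, B, P, Q} \<subseteq> carrier_mat n n" using A B by (auto simp: P_def Q_def)
  have P: "P \<in> carrier_mat n n" and Q: "Q \<in> carrier_mat n n" by (auto simp: P_def Q_def)
  have dims: "dim_row A = n" "dim_col A = n" "dim_row B = n" "dim_col B = n"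
    using A B by auto
  have PQ: "P * Q = 1\<^sub>m n"
    by (rule eq_matI)
      (auto simp: P_def Q_def scalar_prod_def fl inj if_distrib[of "\<lambda>x. x * _"] cong: if_cong)
  show "P * Q = 1\<^sub>m n" by (fact PQ)
  show "Q * P = 1\<^sub>m n" by (rule mat_mult_left_right_inverse[OF P Q PQ])
  show "A = P * B * Q"
    by (rule eq_matI)
      (auto simp: P_def Q_def scalar_prod_def fl AB dims if_distrib[of "\<lambda>x. x * _"]
        if_distrib[of "\<lambda>x. _ * x"] cong: if_cong)
qed

lemma char_poly_laplacian_mat_eq:
  assumes xs: "distinct xs" and ys: "distinct ys" and eq: "set xs = set ys"
  shows "char_poly (laplacian_mat G xs) = char_poly (laplacian_mat G ys)"
proof (rule char_poly_similar)
  define n where "n = length xs"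
  have len: "length xs = n" "length ys = n"
    using distinct_card[OF xs] distinct_card[OF ys] eq by (auto simp: n_def)
  have bx: "bij_betw ((!) xs) {0..<n} (set xs)" and by': "bij_betw ((!) ys) {0..<n} (set xs)"
    using bij_betw_nth[OF xs, of "{0..<n}"] bij_betw_nth[OF ys, of "{0..<n}"] len eq
    by (auto simp: lessThan_atLeast0)
  define f where "f = inv_into {0..<n} ((!) ys) \<circ> (!) xs"
  have f: "bij_betw f {0..<n} {0..<n}"
    unfolding f_def by (rule bij_betw_trans[OF bx bij_betw_inv_into[OF by']])
  have fl: "f i < n" if "i < n" for i using f that by (auto dest: bij_betwE)
  have fi: "ys ! f i = xs ! i" if "i < n" for i
    unfolding f_def o_def by (rule bij_betw_inv_into_right[OF by']) (use that len in auto)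
  have inj: "f i = f j \<longleftrightarrow> i = j" if "i < n" "j < n" for i j
    using f that by (auto simp: bij_betw_def inj_on_def)
  show "similar_mat (laplacian_mat G xs) (laplacian_mat G ys)"
  proof (rule similar_mat_reindex[OF _ _ f])
    show "laplacian_mat G xs \<in> carrier_mat n n" "laplacian_mat G ys \<in> carrier_mat n n"
      using laplacian_mat_carrier[of G xs] laplacian_mat_carrier[of G ys] len by auto
    show "laplacian_mat G xs $$ (i, j) = laplacian_mat G ys $$ (f i, f j)" if "i < n" "j < n" for i j
      using that fl by (simp add: laplacian_mat_index len fi inj)
  qed
qed

lemma laplacian_spectrum_eq:
  assumes "distinct xs" "set xs = pverts G"
  shows "laplacian_spectrum G = proots (char_poly (laplacian_mat G xs))"
proof -
  have fin: "finite (pverts G)" using assms(2) by (metis finite_set)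
  show ?thesis unfolding laplacian_spectrum_def
    using char_poly_laplacian_mat_eq[OF vertex_list(1)[OF fin] assms(1), of G]
      vertex_list(2)[OF fin] assms(2) by simp
qed

lemma real_symmetric_eigenvalue_real:
  fixes A :: "real mat" and z :: complex
  assumes A: "A \<in> carrier_mat n n"
    and sym: "\<And>i j. i < n \<Longrightarrow> j < n \<Longrightarrow> A $$ (i, j) = A $$ (j, i)"
    and z: "eigenvalue (map_mat of_real A) z"
  shows "z \<in> \<real>"
proof -
  let ?A = "map_mat of_real A :: complex mat"
  obtain v where v: "v \<in> carrier_vec n" "v \<noteq> 0\<^sub>v n" "?A *\<^sub>v v = z \<cdot>\<^sub>v v"
    using z A unfolding eigenvalue_def eigenvector_def by auto
  have row: "(\<Sum>j<n. of_real (A $$ (i, j)) * v $ j) = z * v $ i" if i: "i < n" for i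
  proof -
    have "(?A *\<^sub>v v) $ i = (\<Sum>j<n. of_real (A $$ (i, j)) * v $ j)"
      using i v(1) A by (auto simp: scalar_prod_def lessThan_atLeast0 intro!: sum.cong)
    then show ?thesis using v(1,3) i by auto
  qed
  define q where "q = (\<Sum>i<n. \<Sum>j<n. cnj (v $ i) * of_real (A $$ (i, j)) * v $ j)"
  define s where "s = (\<Sum>i<n. (cmod (v $ i))\<^sup>2)"
  have "cnj q = (\<Sum>i<n. \<Sum>j<n. v $ i * of_real (A $$ (i, j)) * cnj (v $ j))"
    by (simp add: q_def)
  also have "\<dots> = (\<Sum>j<n. \<Sum>i<n. v $ i * of_real (A $$ (i, j)) * cnj (v $ j))"
    by (rule sum.swap)
  also have "\<dots> = q"
    unfolding q_def by (intro sum.cong) (auto simp: sym)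
  finally have qr: "q \<in> \<real>" by (simp add: Reals_cnj_iff)
  have "q = (\<Sum>i<n. cnj (v $ i) * (z * v $ i))"
    unfolding q_def by (intro sum.cong) (auto simp: row[symmetric] sum_distrib_left mult.assoc)
  also have "\<dots> = z * of_real s"
    unfolding s_def of_real_sum sum_distrib_left
    by (intro sum.cong) (auto simp: complex_norm_square mult_ac simp del: of_real_power)
  finally have q: "q = z * of_real s" .
  have "s \<noteq> 0"
  proof
    assume "s = 0"
    then have "\<forall>i<n. v $ i = 0" unfolding s_def by (subst (asm) sum_nonneg_eq_0_iff) auto
    with v(1,2) show False by (metis carrier_vecD eq_vecI index_zero_vec)
  qed
  then have "z = q / of_real s" using q by simp
  then show ?thesis using qr by simp
qed

lemma size_proots_char_poly_real_symmetric:
  fixes A :: "real mat"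
  assumes A: "A \<in> carrier_mat n n"
    and sym: "\<And>i j. i < n \<Longrightarrow> j < n \<Longrightarrow> A $$ (i, j) = A $$ (j, i)"
  shows "size (proots (char_poly A)) = n"
proof -
  let ?A = "map_mat of_real A :: complex mat"
  have A': "?A \<in> carrier_mat n n" using A by auto
  obtain as where as: "char_poly ?A = (\<Prod>a\<leftarrow>as. [:- a, 1:])" "length as = n"
    using char_poly_factorized[OF A'] by auto
  have re: "of_real (Re a) = a" if "a \<in> set as" for a
  proof -
    have "poly (char_poly ?A) a = 0"
      using that unfolding as(1) by (auto simp: poly_prod_list prod_list_zero_iff)
    then have "eigenvalue ?A a" by (simp add: eigenvalue_root_char_poly[OF A'])
    then show ?thesis by (simp add: real_symmetric_eigenvalue_real[OF A sym])
  qed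
  interpret map_poly_inj_idom_hom "of_real :: real \<Rightarrow> complex" ..
  have *: "map_poly of_real (\<Prod>a\<leftarrow>bs. [:- Re a, 1:]) = (\<Prod>a\<leftarrow>bs. [:- a, 1:])"
    if "\<And>a. a \<in> set bs \<Longrightarrow> of_real (Re a) = a" for bs
    using that by (induction bs) (auto simp: hom_mult simp del: mult_pCons_left)
  have "map_poly of_real (char_poly A) = char_poly ?A"
    by (simp add: of_real_hom.char_poly_hom[OF A])
  also have "\<dots> = map_poly of_real (\<Prod>a\<leftarrow>as. [:- Re a, 1:])"
    using as(1) *[OF re] by simp
  finally have "char_poly A = (\<Prod>a\<leftarrow>as. [:- Re a, 1:])" by simp
  moreover have "size (proots (\<Prod>a\<leftarrow>bs. [:- Re a, 1:])) = length bs" for bs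
  proof (induction bs)
    case (Cons b bs)
    have "(\<Prod>a\<leftarrow>bs. [:- Re a, 1:]) \<noteq> 0" by (auto simp: prod_list_zero_iff)
    with Cons show ?case by (simp add: proots_mult del: mult_pCons_left)
  qed simp
  ultimately show ?thesis using as(2) by simp
qed

lemma size_laplacian_spectrum:
  assumes "pair_graph G"
  shows "size (laplacian_spectrum G) = card (pverts G)"
proof -
  interpret pair_graph G by fact
  have symm: "(u, v) \<in> parcs G \<longleftrightarrow> (v, u) \<in> parcs G" for u v
    by (metis arcs_symmetric)
  have len: "length (vertex_list G) = card (pverts G)"
    using vertex_list[of G] distinct_card by fastforce
  show ?thesis unfolding laplacian_spectrum_def len[symmetric]
    by (rule size_proots_char_poly_real_symmetric[OF laplacian_mat_carrier])
      (auto simp: laplacian_mat_index symm)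
qed

end

theory Submission
  imports Defs "Jordan_Normal_Form.Schur_Decomposition"
begin

text \<open>
  The spectrum of \<open>P\<^sub>n\<close> is \<open>2 - 2 cos (k \<pi> / n)\<close>, and summing the cosines bounds \<open>LE(P\<^sub>n)\<close> by
  \<open>1.274 n - 1 / n\<close>. For a lower bound on \<open>LE(T)\<close> we use Ky Fan's principle: since the numbers
  \<open>\<mu>\<^sub>i - d\<close>, with \<open>d\<close> the average degree, sum to 0, \<open>LE(T)\<close> is at least twice the sum of \<open>R(f) - d\<close> over
  any orthogonal family of functions \<open>f\<close>, where \<open>R\<close> is the Rayleigh quotient of the Laplacian.
  A tree of diameter 4 consists of a centre, its neighbours, and \<open>s\<^sub>x\<close> leaves at each neighbour \<open>x\<close>.
  The indicator of the centre together with, for each \<open>x\<close> with \<open>s\<^sub>x > 0\<close>, the function with value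
  \<open>s\<^sub>x + 1\<close> at \<open>x\<close> and \<open>-1\<close> at its leaves (nearly the top eigenvector of that star) suffices except
  for twelve trees on at most 9 vertices. One of them is \<open>P\<^sub>5\<close>; each of the others has an explicit integer
  family that is good enough.
\<close>

section \<open>Spectra of real symmetric matrices\<close>

text \<open>Ky Fan's principle makes it unnecessary to know the spectrum of the tree: every
  orthogonal family, even one with rounded integer values, gives a valid bound, and only its loss
  matters. The general family is weakest when every neighbour of the centre carries exactly one
  leaf; there it yields about 1.6 n - 3.6, against about 4 n / pi for the path. The slopes settle
  all large n, but for small n the additive loss exceeds the gap. Hence the care with small
  constants (pi >= 3.14, the correction - 1 / n for the path), the separate families, and the
  special role of the path on 5 vertices: both sides coincide there, so no lossy estimate can
  succeed.

  On the combinatorial side, acyclicity enters only in the form that every edge is a bridge. Rooting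
  the tree at the midpoint of a walk that realises the diameter then gives unique parents and at
  most two levels.\<close>

lemma real_symmetric_eigenvector_orthogonal_mat:
  fixes A :: "real mat"
  assumes A: "A \<in> carrier_mat n n" and n: "0 < n"
    and sym: "\<And>i j. i < n \<Longrightarrow> j < n \<Longrightarrow> A $$ (i, j) = A $$ (j, i)"
  shows "\<exists>W e. W \<in> carrier_mat n n \<and> W\<^sup>T * W = 1\<^sub>m n \<and> A *\<^sub>v col W 0 = e \<cdot>\<^sub>v col W 0"
proof -
  interpret cof_vec_space n "TYPE(real)" .
  \<comment> \<open>All n eigenvalues are real, so for n > 0 there is at least one.\<close>
  have "proots (char_poly A) \<noteq> {#}"
    using size_proots_char_poly_real_symmetric[OF A sym] n by auto
  then obtain e where "e \<in># proots (char_poly A)" by blast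
  then have "poly (char_poly A) e = 0"
    by (cases "char_poly A = 0") auto
  then have "eigenvalue A e" by (simp add: eigenvalue_root_char_poly[OF A])
  then obtain v where v: "v \<in> carrier_vec n" "v \<noteq> 0\<^sub>v n" and ev: "A *\<^sub>v v = e \<cdot>\<^sub>v v"
    using A unfolding eigenvalue_def eigenvector_def by auto
  \<comment> \<open>Gram-Schmidt keeps the head of the basis, so after normalisation column 0 is
    still a multiple of the eigenvector v.\<close>
  define b where "b = basis_completion v"
  define ws where "ws = gram_schmidt n b"
  from basis_completion[OF v, folded b_def]
  have dist_b: "distinct b" and indep: "\<not> lin_dep (set b)" and b: "set b \<subseteq> carrier_vec n"
    and hdb: "hd b = v" and len_b: "length b = n" by auto
  from hdb len_b n obtain vs where bv: "b = v # vs" by (cases b) auto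
  from gram_schmidt_result[OF b dist_b indep refl, folded ws_def]
  have ws: "set ws \<subseteq> carrier_vec n" "corthogonal ws" "length ws = n" by (auto simp: len_b)
  have ws0: "ws ! 0 = v"
    using gram_schmidt_hd[OF v(1), of vs, folded bv] ws(3) n unfolding ws_def
    by (metis hd_conv_nth length_0_conv less_irrefl)
  have wsc: "ws ! j \<in> carrier_vec n" if "j < n" for j using ws that by auto
  have orth: "(ws ! i \<bullet> ws ! j = 0) = (i \<noteq> j)" if "i < n" "j < n" for i j
    using corthogonalD[OF ws(2), of i j] ws(3) that by simp
  have pos: "0 < ws ! j \<bullet> ws ! j" if "j < n" for j
    using orth[OF that that] conjugate_square_ge_0_vec[of "ws ! j"] by simp
  define W where "W = mat n n (\<lambda>(i, j). ws ! j $ i / sqrt (ws ! j \<bullet> ws ! j))"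
  have W: "W \<in> carrier_mat n n" by (simp add: W_def)
  have colW: "col W j = (1 / sqrt (ws ! j \<bullet> ws ! j)) \<cdot>\<^sub>v ws ! j" if "j < n" for j
    using wsc[OF that] that by (intro eq_vecI) (auto simp: W_def)
  have "W\<^sup>T * W = 1\<^sub>m n"
  proof (rule eq_matI)
    fix i j assume "i < dim_row (1\<^sub>m n)" "j < dim_col (1\<^sub>m n)"
    then have ij: "i < n" "j < n" by auto
    have "(W\<^sup>T * W) $$ (i, j) = col W i \<bullet> col W j" using ij W by auto
    also have "\<dots> = ws ! i \<bullet> ws ! j / (sqrt (ws ! i \<bullet> ws ! i) * sqrt (ws ! j \<bullet> ws ! j))"
      using ij wsc by (simp add: colW smult_scalar_prod_distrib[of _ n] scalar_prod_smult_distrib[of _ n])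
    also have "\<dots> = 1\<^sub>m n $$ (i, j)"
      using ij orth[OF ij] pos[OF ij(1)] by (auto simp: real_sqrt_mult_self)
    finally show "(W\<^sup>T * W) $$ (i, j) = 1\<^sub>m n $$ (i, j)" .
  qed (use W in auto)
  moreover have "A *\<^sub>v col W 0 = e \<cdot>\<^sub>v col W 0"
    using A v n ev ws0 by (simp add: colW mult_mat_vec smult_smult_assoc mult.commute)
  ultimately show ?thesis using W by blast
qed

text \<open>Deflation: conjugation by the orthogonal matrix W turns column 0 into e times the first
  unit vector; symmetry clears row 0 as well, and the induction continues on the remaining symmetric
  block.\<close>

theorem real_symmetric_diagonalization:
  fixes A :: "real mat"
  assumes "A \<in> carrier_mat n n"
    and "\<And>i j. i < n \<Longrightarrow> j < n \<Longrightarrow> A $$ (i, j) = A $$ (j, i)"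
  shows "\<exists>U D. U \<in> carrier_mat n n \<and> D \<in> carrier_mat n n \<and> diagonal_mat D \<and>
    U\<^sup>T * U = 1\<^sub>m n \<and> A = U * D * U\<^sup>T"
  using assms
proof (induction n arbitrary: A)
  case 0
  then show ?case
    by (intro exI[of _ "1\<^sub>m 0"] exI[of _ A]) (auto simp: diagonal_mat_def)
next
  case (Suc n)
  let ?m = "Suc n"
  note A = Suc.prems(1)
  obtain W e where W: "W \<in> carrier_mat ?m ?m" and WW: "W\<^sup>T * W = 1\<^sub>m ?m"
    and ev: "A *\<^sub>v col W 0 = e \<cdot>\<^sub>v col W 0"
    using real_symmetric_eigenvector_orthogonal_mat[OF A _ Suc.prems(2)] by auto
  have WW': "W * W\<^sup>T = 1\<^sub>m ?m"
    by (rule mat_mult_left_right_inverse[OF _ W WW]) (use W in auto)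
  define B where "B = W\<^sup>T * A * W"
  have B: "B \<in> carrier_mat ?m ?m" using W A by (auto simp: B_def)
  have AT: "A\<^sup>T = A" using A Suc.prems(2) by (intro eq_matI) auto
  have BT: "B\<^sup>T = B"
    unfolding B_def using W A
    by (simp add: transpose_mult[of _ ?m ?m _ ?m] AT assoc_mult_mat[of _ ?m ?m _ ?m _ ?m])
  have AB: "A = W * B * W\<^sup>T"
  proof -
    have "W * B * W\<^sup>T = (W * W\<^sup>T) * A * (W * W\<^sup>T)"
      unfolding B_def using W A by (simp add: assoc_mult_mat[of _ ?m ?m _ ?m _ ?m])
    then show ?thesis using A by (simp add: WW')
  qed
  have B0: "B $$ (i, 0) = (if i = 0 then e else 0)" if "i < ?m" for i
  proof -
    have [simp]: "col W 0 \<in> carrier_vec ?m" using W by (metis carrier_matD(1) col_dim)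
    have "col B 0 = W\<^sup>T *\<^sub>v (A *\<^sub>v col W 0)"
      unfolding B_def using W A
      by (subst col_mult2[of _ ?m ?m _ ?m])
        (auto intro!: assoc_mult_mat_vec[of _ ?m ?m _ ?m])
    also have "\<dots> = e \<cdot>\<^sub>v col (W\<^sup>T * W) 0"
      unfolding ev using W
      by (subst col_mult2[of _ ?m ?m _ ?m]) (auto intro!: mult_mat_vec[of _ ?m ?m])
    finally have "col B 0 $ i = (e \<cdot>\<^sub>v col (1\<^sub>m ?m) 0) $ i" by (simp add: WW)
    then show ?thesis using that B by auto
  qed
  have B0': "B $$ (0, i) = (if i = 0 then e else 0)" if "i < ?m" for i
    using B0[OF that] BT B that by (metis carrier_matD index_transpose_mat(1) zero_less_Suc)
  define B3 where "B3 = mat n n (\<lambda>(i, j). B $$ (Suc i, Suc j))"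
  define E where "E = mat 1 1 (\<lambda>_. e)"
  have E: "E \<in> carrier_mat 1 1" by (simp add: E_def)
  have B3: "B3 \<in> carrier_mat n n" by (simp add: B3_def)
  have Bb: "B = four_block_mat E (0\<^sub>m 1 n) (0\<^sub>m n 1) B3"
    using B by (intro eq_matI) (auto simp: B3_def E_def B0 B0')
  have "B3 $$ (i, j) = B3 $$ (j, i)" if "i < n" "j < n" for i j
    using that BT B unfolding B3_def by simp (metis Suc_mono carrier_matD index_transpose_mat(1))
  from Suc.IH[OF B3 this] obtain U D where U: "U \<in> carrier_mat n n" and D: "D \<in> carrier_mat n n"
    and dD: "diagonal_mat D" and UU: "U\<^sup>T * U = 1\<^sub>m n" and B3U: "B3 = U * D * U\<^sup>T" by blast
  define V where "V = four_block_mat (1\<^sub>m 1) (0\<^sub>m 1 n) (0\<^sub>m n 1) U"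
  define F where "F = four_block_mat E (0\<^sub>m 1 n) (0\<^sub>m n 1) D"
  have VT: "V\<^sup>T = four_block_mat (1\<^sub>m 1) (0\<^sub>m 1 n) (0\<^sub>m n 1) (U\<^sup>T)"
    unfolding V_def using U by (subst transpose_four_block_mat[of _ 1 1 _ n _ n]) auto
  have V: "V \<in> carrier_mat ?m ?m" and F: "F \<in> carrier_mat ?m ?m"
    using U D E by (auto simp: V_def F_def)
  have VV: "V\<^sup>T * V = 1\<^sub>m ?m"
    unfolding VT unfolding V_def
    by (subst mult_four_block_mat[of _ 1 1 _ n _ n _ _ 1 _ n]) (use U UU in \<open>auto simp: four_block_one_mat\<close>)
  have "V * F = four_block_mat E (0\<^sub>m 1 n) (0\<^sub>m n 1) (U * D)"
    unfolding V_def F_def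
    by (subst mult_four_block_mat[of _ 1 1 _ n _ n _ _ 1 _ n]) (use U D E in auto)
  then have VFV: "V * F * V\<^sup>T = B"
    unfolding VT Bb B3U
    by (simp only:) (subst mult_four_block_mat[of _ 1 1 _ n _ n _ _ 1 _ n], use U D E in auto)
  have "diagonal_mat F"
    using dD D E unfolding diagonal_mat_def F_def by auto
  moreover have "(W * V)\<^sup>T * (W * V) = 1\<^sub>m ?m"
  proof -
    have "(W * V)\<^sup>T * (W * V) = V\<^sup>T * ((W\<^sup>T * W) * V)"
      using W V by (simp add: transpose_mult[of _ ?m ?m _ ?m] assoc_mult_mat[of _ ?m ?m _ ?m _ ?m])
    then show ?thesis using V by (simp add: WW VV)
  qed
  moreover have "A = (W * V) * F * (W * V)\<^sup>T"
    unfolding AB VFV[symmetric]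
    using W V F by (simp add: transpose_mult[of _ ?m ?m _ ?m] assoc_mult_mat[of _ ?m ?m _ ?m _ ?m])
  ultimately show ?case using W V F by (intro exI[of _ "W * V"] exI[of _ F]) auto
qed

section \<open>Spectral decomposition in coordinates and Ky Fan's principle\<close>

lemma proots_prod_list_linear:
  "proots (\<Prod>a\<leftarrow>xs. [:- a, 1:]) = mset (xs :: real list)"
proof (induction xs)
  case (Cons x xs)
  have "(\<Prod>a\<leftarrow>xs. [:- a, 1:]) \<noteq> 0" by (auto simp: prod_list_zero_iff)
  with Cons show ?case by (simp add: proots_mult del: mult_pCons_left)
qed simp

text \<open>Both orthogonality relations are recorded: the one for columns says that the
  eigenvectors are unit vectors and gives the trace, the one for rows gives Parseval's
  identity.\<close>

lemma real_symmetric_spectral_sums: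
  fixes A :: "real mat"
  assumes A: "A \<in> carrier_mat n n"
    and sym: "\<And>i j. i < n \<Longrightarrow> j < n \<Longrightarrow> A $$ (i, j) = A $$ (j, i)"
  obtains U :: "nat \<Rightarrow> nat \<Rightarrow> real" and \<mu> :: "nat \<Rightarrow> real" where
    "\<And>i j. i < n \<Longrightarrow> j < n \<Longrightarrow> (\<Sum>k<n. U k i * U k j) = of_bool (i = j)"
    "\<And>i j. i < n \<Longrightarrow> j < n \<Longrightarrow> (\<Sum>k<n. U i k * U j k) = of_bool (i = j)"
    "\<And>i j. i < n \<Longrightarrow> j < n \<Longrightarrow> A $$ (i, j) = (\<Sum>k<n. \<mu> k * U i k * U j k)"
    "proots (char_poly A) = image_mset \<mu> (mset_set {..<n})"
proof -
  obtain U D where U: "U \<in> carrier_mat n n" and D: "D \<in> carrier_mat n n" and dD: "diagonal_mat D"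
    and UU: "U\<^sup>T * U = 1\<^sub>m n" and AU: "A = U * D * U\<^sup>T"
    using real_symmetric_diagonalization[OF A sym] by blast
  have UU': "U * U\<^sup>T = 1\<^sub>m n"
    by (rule mat_mult_left_right_inverse[OF _ U UU]) (use U in auto)
  have "similar_mat A D"
    by (rule similar_matI[of _ _ U "U\<^sup>T"]) (use A U D UU UU' AU in auto)
  then have "char_poly A = char_poly D" by (rule char_poly_similar)
  also have "\<dots> = (\<Prod>a\<leftarrow>diag_mat D. [:- a, 1:])"
    by (rule char_poly_upper_triangular[OF D])
      (use dD D in \<open>auto simp: diagonal_mat_def upper_triangular_def\<close>)
  finally have "proots (char_poly A) = mset (diag_mat D)" by (simp add: proots_prod_list_linear)
  also have "\<dots> = image_mset (\<lambda>k. D $$ (k, k)) (mset_set {..<n})"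
    using D by (simp add: diag_mat_def lessThan_atLeast0 flip: mset_upt)
  finally have 4: "proots (char_poly A) = image_mset (\<lambda>k. D $$ (k, k)) (mset_set {..<n})" .
  have 1: "(\<Sum>k<n. U $$ (k, i) * U $$ (k, j)) = of_bool (i = j)" if "i < n" "j < n" for i j
  proof -
    have "(\<Sum>k<n. U $$ (k, i) * U $$ (k, j)) = (U\<^sup>T * U) $$ (i, j)"
      using that U by (auto simp: scalar_prod_def lessThan_atLeast0 intro!: sum.cong)
    then show ?thesis using that by (simp add: UU)
  qed
  have 2: "(\<Sum>k<n. U $$ (i, k) * U $$ (j, k)) = of_bool (i = j)" if "i < n" "j < n" for i j
  proof -
    have "(\<Sum>k<n. U $$ (i, k) * U $$ (j, k)) = (U * U\<^sup>T) $$ (i, j)"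
      using that U by (auto simp: scalar_prod_def lessThan_atLeast0 intro!: sum.cong)
    then show ?thesis using that by (simp add: UU')
  qed
  have 3: "A $$ (i, j) = (\<Sum>k<n. D $$ (k, k) * U $$ (i, k) * U $$ (j, k))" if "i < n" "j < n" for i j
  proof -
    have UD: "(U * D) $$ (i, k) = D $$ (k, k) * U $$ (i, k)" if k: "k < n" for k
    proof -
      have "(U * D) $$ (i, k) = (\<Sum>l<n. U $$ (i, l) * D $$ (l, k))"
        using k \<open>i < n\<close> U D by (auto simp: scalar_prod_def lessThan_atLeast0 intro!: sum.cong)
      also have "\<dots> = (\<Sum>l<n. if l = k then U $$ (i, k) * D $$ (k, k) else 0)"
        using dD D k by (intro sum.cong) (auto simp: diagonal_mat_def)
      finally show ?thesis using k by simp
    qed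
    define E where "E = U * D"
    have E: "E \<in> carrier_mat n n" using U D by (simp add: E_def)
    have "A $$ (i, j) = (\<Sum>k<n. E $$ (i, k) * U $$ (j, k))"
      unfolding AU E_def[symmetric] using that U E
      by (auto simp: scalar_prod_def lessThan_atLeast0 intro!: sum.cong)
    then show ?thesis by (simp add: UD E_def)
  qed
  show ?thesis by (rule that[OF 1 2 3 4])
qed

text \<open>Expand the square of u minus its projection p. The \<open>f i\<close> are orthogonal but
  not normalised, so that integer families can be used without square roots.\<close>

lemma bessel_inequality_sums:
  fixes u :: "'k \<Rightarrow> real" and f :: "'i \<Rightarrow> 'k \<Rightarrow> real"
  assumes K: "finite K" and I: "finite I"
    and orth: "\<And>i j. i \<in> I \<Longrightarrow> j \<in> I \<Longrightarrow> i \<noteq> j \<Longrightarrow> (\<Sum>k\<in>K. f i k * f j k) = 0"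
    and pos: "\<And>i. i \<in> I \<Longrightarrow> 0 < (\<Sum>k\<in>K. (f i k)\<^sup>2)"
  shows "(\<Sum>i\<in>I. (\<Sum>k\<in>K. u k * f i k)\<^sup>2 / (\<Sum>k\<in>K. (f i k)\<^sup>2)) \<le> (\<Sum>k\<in>K. (u k)\<^sup>2)"
proof -
  define a where "a i = (\<Sum>k\<in>K. u k * f i k)" for i
  define b where "b i = (\<Sum>k\<in>K. (f i k)\<^sup>2)" for i
  define p where "p k = (\<Sum>i\<in>I. a i / b i * f i k)" for k
  have ff: "(\<Sum>k\<in>K. f i k * f j k) = (if i = j then b i else 0)" if "i \<in> I" "j \<in> I" for i j
    using orth[OF that] by (auto simp: b_def power2_eq_square)
  have up: "(\<Sum>k\<in>K. u k * p k) = (\<Sum>i\<in>I. (a i)\<^sup>2 / b i)"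
  proof -
    have "(\<Sum>k\<in>K. u k * p k) = (\<Sum>k\<in>K. \<Sum>i\<in>I. a i / b i * (u k * f i k))"
      by (simp add: p_def sum_distrib_left mult_ac)
    also have "\<dots> = (\<Sum>i\<in>I. a i / b i * a i)"
      by (subst sum.swap) (simp add: a_def sum_distrib_left)
    finally show ?thesis by (simp add: power2_eq_square)
  qed
  have pp: "(\<Sum>k\<in>K. (p k)\<^sup>2) = (\<Sum>i\<in>I. (a i)\<^sup>2 / b i)"
  proof -
    have "(\<Sum>k\<in>K. (p k)\<^sup>2) = (\<Sum>k\<in>K. \<Sum>i\<in>I. \<Sum>j\<in>I. (a i / b i) * (a j / b j) * (f i k * f j k))"
      by (simp add: p_def power2_eq_square sum_product mult_ac)
    also have "\<dots> = (\<Sum>i\<in>I. \<Sum>j\<in>I. (a i / b i) * (a j / b j) * (\<Sum>k\<in>K. f i k * f j k))"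
      unfolding sum_distrib_left by (subst sum.swap, rule sum.cong[OF refl], subst sum.swap) simp
    also have "\<dots> = (\<Sum>i\<in>I. \<Sum>j\<in>I. if i = j then (a i / b i) * (a i / b i) * b i else 0)"
      by (intro sum.cong) (auto simp: ff)
    also have "\<dots> = (\<Sum>i\<in>I. (a i)\<^sup>2 / b i)"
      using I pos by (auto simp: b_def power2_eq_square intro!: sum.cong)
    finally show ?thesis .
  qed
  have "0 \<le> (\<Sum>k\<in>K. (u k - p k)\<^sup>2)" by (intro sum_nonneg) auto
  also have "\<dots> = (\<Sum>k\<in>K. (u k)\<^sup>2) - 2 * (\<Sum>k\<in>K. u k * p k) + (\<Sum>k\<in>K. (p k)\<^sup>2)"
    by (simp add: power2_diff sum.distrib sum_subtractf sum_distrib_left algebra_simps)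
  finally show ?thesis using up pp by (simp add: a_def b_def)
qed

text \<open>Ky Fan's principle: the eigenvalues are tested against \<open>2P - 1\<close>, with \<open>P\<close> the orthogonal
  projection onto the span of the \<open>f i\<close>.\<close>

lemma sum_abs_eigenvalues_ge:
  fixes A :: "real mat" and f :: "'i \<Rightarrow> nat \<Rightarrow> real"
  assumes A: "A \<in> carrier_mat n n"
    and sym: "\<And>i j. i < n \<Longrightarrow> j < n \<Longrightarrow> A $$ (i, j) = A $$ (j, i)"
    and I: "finite I"
    and orth: "\<And>i j. i \<in> I \<Longrightarrow> j \<in> I \<Longrightarrow> i \<noteq> j \<Longrightarrow> (\<Sum>k<n. f i k * f j k) = 0"
    and pos: "\<And>i. i \<in> I \<Longrightarrow> 0 < (\<Sum>k<n. (f i k)\<^sup>2)"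
  shows "2 * (\<Sum>i\<in>I. (\<Sum>k<n. \<Sum>l<n. f i k * A $$ (k, l) * f i l) / (\<Sum>k<n. (f i k)\<^sup>2) - d)
      - ((\<Sum>k<n. A $$ (k, k)) - real n * d)
    \<le> (\<Sum>\<mu>\<in>#proots (char_poly A). \<bar>\<mu> - d\<bar>)"
proof -
  obtain U \<mu> where cols: "\<And>i j. i < n \<Longrightarrow> j < n \<Longrightarrow> (\<Sum>k<n. U k i * U k j) = of_bool (i = j)"
    and rows: "\<And>i j. i < n \<Longrightarrow> j < n \<Longrightarrow> (\<Sum>k<n. U i k * U j k) = (of_bool (i = j) :: real)"
    and AU: "\<And>i j. i < n \<Longrightarrow> j < n \<Longrightarrow> A $$ (i, j) = (\<Sum>k<n. \<mu> k * U i k * U j k)"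
    and pr: "proots (char_poly A) = image_mset \<mu> (mset_set {..<n})"
    using real_symmetric_spectral_sums[OF A sym] by blast
  define a where "a i j = (\<Sum>k<n. U k j * f i k)" for i j
  define b where "b i = (\<Sum>k<n. (f i k)\<^sup>2)" for i
  \<comment> \<open>This is the squared length of the projection of the j-th unit eigenvector onto
    the span of the \<open>f i\<close>. It lies in [0, 1], so the weight \<open>2 * w j - 1\<close>
    lies in [-1, 1].\<close>
  define w where "w j = (\<Sum>i\<in>I. (a i j)\<^sup>2 / b i)" for j
  have b: "0 < b i" if "i \<in> I" for i using pos[OF that] by (simp add: b_def)
  have w1: "w j \<le> 1" if "j < n" for j
    using bessel_inequality_sums[OF finite_lessThan I orth pos, where u = "\<lambda>k. U k j"] cols[OF that that]
    by (simp add: w_def a_def b_def power2_eq_square)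
  have w0: "0 \<le> w j" for j
    unfolding w_def using b by (intro sum_nonneg divide_nonneg_pos) auto
  \<comment> \<open>One identity for arbitrary weights c: c = 1 gives Parseval, and c = \<mu> gives
    the quadratic form of A.\<close>
  have q: "(\<Sum>k<n. \<Sum>l<n. f i k * (\<Sum>j<n. c j * U k j * U l j) * f i l) = (\<Sum>j<n. c j * (a i j)\<^sup>2)"
    for i and c :: "nat \<Rightarrow> real"
  proof -
    have "(\<Sum>j<n. c j * (a i j)\<^sup>2) = (\<Sum>j<n. \<Sum>k<n. \<Sum>l<n. f i k * (c j * U k j * U l j) * f i l)"
      by (simp add: a_def power2_eq_square sum_product sum_distrib_left mult_ac)
    also have "\<dots> = (\<Sum>k<n. \<Sum>l<n. \<Sum>j<n. f i k * (c j * U k j * U l j) * f i l)"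
      by (subst sum.swap, rule sum.cong[OF refl], subst sum.swap) simp
    finally show ?thesis by (simp add: sum_distrib_left sum_distrib_right)
  qed
  have b': "b i = (\<Sum>j<n. (a i j)\<^sup>2)" for i
  proof -
    have "(\<Sum>j<n. (a i j)\<^sup>2) = (\<Sum>k<n. \<Sum>l<n. f i k * of_bool (k = l) * f i l)"
      using q[of i "\<lambda>_. 1"] by (simp add: rows)
    also have "\<dots> = (\<Sum>k<n. \<Sum>l<n. if k = l then f i k * f i k else 0)"
      by (intro sum.cong) auto
    finally show ?thesis by (simp add: b_def power2_eq_square)
  qed
  have ray: "(\<Sum>k<n. \<Sum>l<n. f i k * A $$ (k, l) * f i l) / b i - d
      = (\<Sum>j<n. (\<mu> j - d) * ((a i j)\<^sup>2 / b i))" if "i \<in> I" for i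
  proof -
    have "(\<Sum>k<n. \<Sum>l<n. f i k * A $$ (k, l) * f i l) = (\<Sum>j<n. \<mu> j * (a i j)\<^sup>2)"
      using q[of i \<mu>] by (auto simp: AU intro!: sum.cong)
    moreover have "(\<Sum>j<n. (\<mu> j - d) * ((a i j)\<^sup>2 / b i))
        = (\<Sum>j<n. \<mu> j * (a i j)\<^sup>2) / b i - d * ((\<Sum>j<n. (a i j)\<^sup>2) / b i)"
      by (simp add: left_diff_distrib diff_divide_distrib sum_subtractf sum_divide_distrib sum_distrib_left)
    ultimately show ?thesis using b[OF that] by (simp flip: b')
  qed
  have tr: "(\<Sum>k<n. A $$ (k, k)) = (\<Sum>j<n. \<mu> j)"
  proof -
    have "(\<Sum>k<n. A $$ (k, k)) = (\<Sum>k<n. \<Sum>j<n. \<mu> j * (U k j * U k j))"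
      by (simp add: AU mult_ac)
    also have "\<dots> = (\<Sum>j<n. \<mu> j * (\<Sum>k<n. U k j * U k j))"
      by (subst sum.swap) (simp add: sum_distrib_left)
    finally show ?thesis by (simp add: cols)
  qed
  have "2 * (\<Sum>i\<in>I. (\<Sum>k<n. \<Sum>l<n. f i k * A $$ (k, l) * f i l) / b i - d)
      - ((\<Sum>k<n. A $$ (k, k)) - real n * d)
    = 2 * (\<Sum>i\<in>I. \<Sum>j<n. (\<mu> j - d) * ((a i j)\<^sup>2 / b i)) - (\<Sum>j<n. \<mu> j - d)"
    by (simp add: ray tr sum_subtractf)
  also have "(\<Sum>i\<in>I. \<Sum>j<n. (\<mu> j - d) * ((a i j)\<^sup>2 / b i)) = (\<Sum>j<n. (\<mu> j - d) * w j)"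
    by (subst sum.swap) (simp add: w_def sum_distrib_left)
  also have "2 * (\<Sum>j<n. (\<mu> j - d) * w j) - (\<Sum>j<n. \<mu> j - d) = (\<Sum>j<n. (\<mu> j - d) * (2 * w j - 1))"
    by (simp add: sum_distrib_left right_diff_distrib sum_subtractf mult_ac)
  also have "\<dots> \<le> (\<Sum>j<n. \<bar>\<mu> j - d\<bar>)"
  proof (rule sum_mono)
    fix j assume "j \<in> {..<n}"
    then have "\<bar>2 * w j - 1\<bar> \<le> 1" using w0[of j] w1[of j] by auto
    then have "\<bar>\<mu> j - d\<bar> * \<bar>2 * w j - 1\<bar> \<le> \<bar>\<mu> j - d\<bar>" by (simp add: mult_left_le)
    then show "(\<mu> j - d) * (2 * w j - 1) \<le> \<bar>\<mu> j - d\<bar>" by (simp flip: abs_mult)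
  qed
  also have "\<dots> = (\<Sum>\<mu>\<in>#proots (char_poly A). \<bar>\<mu> - d\<bar>)"
    by (simp add: pr image_mset.compositionality comp_def sum_unfold_sum_mset)
  finally show ?thesis by (simp add: b_def)
qed

section \<open>Laplacian energy of graphs\<close>

lemma sum_parcs:
  fixes g :: "'a \<times> 'a \<Rightarrow> 'b::comm_monoid_add"
  assumes "pair_graph G"
  shows "(\<Sum>e\<in>parcs G. g e) = (\<Sum>u\<in>pverts G. \<Sum>v\<in>pverts G. if (u, v) \<in> parcs G then g (u, v) else 0)"
proof -
  interpret pair_graph G by fact
  have "(\<Sum>u\<in>pverts G. \<Sum>v\<in>pverts G. if (u, v) \<in> parcs G then g (u, v) else 0)
      = (\<Sum>e\<in>pverts G \<times> pverts G. if e \<in> parcs G then g e else 0)"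
    by (subst sum.cartesian_product) (intro sum.cong, auto)
  also have "\<dots> = (\<Sum>e\<in>(pverts G \<times> pverts G) \<inter> parcs G. g e)"
    by (subst sum.inter_restrict) simp_all
  also have "(pverts G \<times> pverts G) \<inter> parcs G = parcs G"
    by (auto dest: in_arcsD1 in_arcsD2)
  finally show ?thesis ..
qed

lemma out_degree_eq_sum:
  assumes "pair_graph G" "u \<in> pverts G"
  shows "real (out_degree (with_proj G) u) = (\<Sum>v\<in>pverts G. if (u, v) \<in> parcs G then 1 else 0)"
proof -
  interpret pair_graph G by fact
  have "out_arcs (with_proj G) u = Pair u ` {v \<in> pverts G. (u, v) \<in> parcs G}"
    by (auto simp: out_arcs_def dest: in_arcsD2)
  then have "out_degree (with_proj G) u = card {v \<in> pverts G. (u, v) \<in> parcs G}"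
    by (simp add: out_degree_def card_image inj_on_def)
  then show ?thesis by (simp add: sum.If_cases Int_def)
qed

lemma card_parcs_eq:
  assumes "pair_graph G"
  shows "card (parcs G) = 2 * card (edge_set G)"
proof -
  interpret pair_graph G by fact
  have im: "edge_set G = (\<lambda>(u, v). {u, v}) ` parcs G"
    by (auto simp: edge_set_def)
  have two: "card {a \<in> parcs G. (case a of (u, v) \<Rightarrow> {u, v}) = e} = 2" if e: "e \<in> edge_set G" for e
  proof -
    obtain u v where uv: "e = {u, v}" "(u, v) \<in> parcs G" using e by (auto simp: edge_set_def)
    have vu: "(v, u) \<in> parcs G" using uv(2) by (rule arcs_symmetric)
    have "{a \<in> parcs G. (case a of (u, v) \<Rightarrow> {u, v}) = e} = {(u, v), (v, u)}"
    proof (intro equalityI subsetI)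
      fix a assume a: "a \<in> {a \<in> parcs G. (case a of (u, v) \<Rightarrow> {u, v}) = e}"
      obtain x y where "a = (x, y)" by (cases a)
      then show "a \<in> {(u, v), (v, u)}" using a uv(1) by (simp add: doubleton_eq_iff)
    next
      fix a assume "a \<in> {(u, v), (v, u)}"
      then show "a \<in> {a \<in> parcs G. (case a of (u, v) \<Rightarrow> {u, v}) = e}"
        using uv vu by (elim insertE) (simp_all add: insert_commute)
    qed
    moreover have "u \<noteq> v" using no_loops' uv by blast
    ultimately show ?thesis by simp
  qed
  have "card (parcs G) = (\<Sum>e\<in>edge_set G. card {a \<in> parcs G. (case a of (u, v) \<Rightarrow> {u, v}) = e})"
    unfolding im card_eq_sum by (rule sum.image_gen) simp
  then show ?thesis by (simp add: two)
qed

text \<open>The correction term of \<open>sum_abs_eigenvalues_ge\<close> vanishes, because the trace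
  of the Laplacian is n times the average degree. Every edge occurs as two arcs, hence the division
  of the Dirichlet sum by 2.\<close>

lemma laplacian_energy_ge_frame:
  fixes f :: "'i \<Rightarrow> 'a \<Rightarrow> real"
  assumes G: "pair_graph G" and I: "finite I"
    and orth: "\<And>i j. i \<in> I \<Longrightarrow> j \<in> I \<Longrightarrow> i \<noteq> j \<Longrightarrow> (\<Sum>v\<in>pverts G. f i v * f j v) = 0"
    and pos: "\<And>i. i \<in> I \<Longrightarrow> 0 < (\<Sum>v\<in>pverts G. (f i v)\<^sup>2)"
  shows "2 * (\<Sum>i\<in>I. (\<Sum>(u, v)\<in>parcs G. (f i u - f i v)\<^sup>2) / 2 / (\<Sum>v\<in>pverts G. (f i v)\<^sup>2)
      - average_degree G) \<le> laplacian_energy G"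
proof -
  interpret pair_graph G by fact
  define xs where "xs = vertex_list G"
  define n where "n = length xs"
  define A where "A = laplacian_mat G xs"
  let ?E = "\<lambda>u v. if (u, v) \<in> parcs G then 1 else 0 :: real"
  let ?deg = "\<lambda>u. real (out_degree (with_proj G) u)"
  have xs: "distinct xs" "set xs = pverts G"
    unfolding xs_def by (rule vertex_list, simp)+
  have sumV: "(\<Sum>k<n. g (xs ! k)) = (\<Sum>v\<in>pverts G. g v)" for g :: "'a \<Rightarrow> real"
    by (rule sum.reindex_bij_betw) (use bij_betw_nth[OF xs(1)] xs(2) n_def in auto)
  have symm: "(u, v) \<in> parcs G \<longleftrightarrow> (v, u) \<in> parcs G" for u v
    by (metis arcs_symmetric)
  have A: "A \<in> carrier_mat n n" unfolding A_def n_def by simp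
  have Aij: "A $$ (i, j) = (if i = j then ?deg (xs ! i) else 0) - ?E (xs ! i) (xs ! j)"
    if "i < n" "j < n" for i j
    using that unfolding A_def n_def by (simp add: laplacian_mat_index)
  have sym: "A $$ (i, j) = A $$ (j, i)" if "i < n" "j < n" for i j
    using that by (simp add: Aij symm)
  have no_loop: "(u, u) \<notin> parcs G" for u using no_loops' by blast
  have deg_sum: "(\<Sum>u\<in>pverts G. ?deg u * g u) = (\<Sum>(u, v)\<in>parcs G. g u)" for g :: "'a \<Rightarrow> real"
    by (auto simp: sum_parcs[OF G] out_degree_eq_sum[OF G] sum_distrib_right intro!: sum.cong)
  have tr: "(\<Sum>k<n. A $$ (k, k)) = real n * average_degree G"
  proof -
    have "(\<Sum>k<n. A $$ (k, k)) = (\<Sum>k<n. ?deg (xs ! k))"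
      by (simp add: Aij no_loop)
    also have "\<dots> = real (card (parcs G))"
      using deg_sum[of "\<lambda>_. 1"] by (simp add: sumV[of ?deg])
    also have "\<dots> = real n * average_degree G"
    proof (cases "n = 0")
      case True
      then have "parcs G = {}" using xs(2) by (auto simp: n_def dest: in_arcsD1)
      then show ?thesis using True by simp
    next
      case False
      have "n = card (pverts G)" using distinct_card[OF xs(1)] xs(2) by (simp add: n_def)
      then show ?thesis using False by (simp add: average_degree_def card_parcs_eq[OF G])
    qed
    finally show ?thesis .
  qed
  have quad: "(\<Sum>k<n. \<Sum>l<n. h (xs ! k) * A $$ (k, l) * h (xs ! l))
      = (\<Sum>(u, v)\<in>parcs G. (h u - h v)\<^sup>2) / 2" for h :: "'a \<Rightarrow> real"
  proof -
    have "(\<Sum>k<n. \<Sum>l<n. h (xs ! k) * A $$ (k, l) * h (xs ! l))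
      = (\<Sum>k<n. \<Sum>l<n. (if k = l then ?deg (xs ! k) * (h (xs ! k))\<^sup>2 else 0)
           - h (xs ! k) * h (xs ! l) * ?E (xs ! k) (xs ! l))"
      by (intro sum.cong) (auto simp: Aij algebra_simps power2_eq_square)
    also have "\<dots> = (\<Sum>k<n. ?deg (xs ! k) * (h (xs ! k))\<^sup>2)
        - (\<Sum>k<n. \<Sum>l<n. h (xs ! k) * h (xs ! l) * ?E (xs ! k) (xs ! l))"
      by (simp add: sum_subtractf)
    also have "(\<Sum>k<n. ?deg (xs ! k) * (h (xs ! k))\<^sup>2) = (\<Sum>(u, v)\<in>parcs G. (h u)\<^sup>2)"
      by (simp add: sumV[of "\<lambda>u. ?deg u * (h u)\<^sup>2"] deg_sum)
    also have "(\<Sum>k<n. \<Sum>l<n. h (xs ! k) * h (xs ! l) * ?E (xs ! k) (xs ! l))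
        = (\<Sum>u\<in>pverts G. \<Sum>v\<in>pverts G. h u * h v * ?E u v)"
      unfolding sumV[of "\<lambda>v. h (xs ! k) * h v * ?E (xs ! k) v" for k]
      by (rule sumV[of "\<lambda>u. \<Sum>v\<in>pverts G. h u * h v * ?E u v"])
    also have "\<dots> = (\<Sum>(u, v)\<in>parcs G. h u * h v)"
      by (auto simp: sum_parcs[OF G] intro!: sum.cong)
    finally have 1: "(\<Sum>k<n. \<Sum>l<n. h (xs ! k) * A $$ (k, l) * h (xs ! l))
        = (\<Sum>(u, v)\<in>parcs G. (h u)\<^sup>2) - (\<Sum>(u, v)\<in>parcs G. h u * h v)" .
    have 2: "(\<Sum>(u, v)\<in>parcs G. (h u)\<^sup>2) = (\<Sum>(u, v)\<in>parcs G. (h v)\<^sup>2)"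
      by (rule sum.reindex_bij_witness[of _ prod.swap prod.swap]) (auto simp: symm)
    have "(\<Sum>(u, v)\<in>parcs G. (h u - h v)\<^sup>2)
        = (\<Sum>(u, v)\<in>parcs G. (h u)\<^sup>2) + (\<Sum>(u, v)\<in>parcs G. (h v)\<^sup>2) - 2 * (\<Sum>(u, v)\<in>parcs G. h u * h v)"
      by (simp add: case_prod_beta power2_diff sum.distrib sum_subtractf sum_distrib_left mult.assoc)
    then show ?thesis using 1 2 by simp
  qed
  have LE: "(\<Sum>\<mu>\<in>#proots (char_poly A). \<bar>\<mu> - average_degree G\<bar>) = laplacian_energy G"
    by (simp add: laplacian_energy_def laplacian_spectrum_def A_def xs_def)
  have "2 * (\<Sum>i\<in>I. (\<Sum>k<n. \<Sum>l<n. f i (xs ! k) * A $$ (k, l) * f i (xs ! l))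
        / (\<Sum>k<n. (f i (xs ! k))\<^sup>2) - average_degree G)
      - ((\<Sum>k<n. A $$ (k, k)) - real n * average_degree G)
    \<le> (\<Sum>\<mu>\<in>#proots (char_poly A). \<bar>\<mu> - average_degree G\<bar>)"
    by (rule sum_abs_eigenvalues_ge[OF A sym I, where f = "\<lambda>i k. f i (xs ! k)"])
      (simp_all add: orth pos sumV[of "\<lambda>v. f _ v * f _ v"] sumV[of "\<lambda>v. (f _ v)\<^sup>2"])
  then show ?thesis
    unfolding LE tr quad[of "f i" for i] sumV[of "\<lambda>v. (f i v)\<^sup>2" for i] by simp
qed

text \<open>Isomorphism invariance, where the isomorphism sends \<open>xs ! i\<close> to
  \<open>ys ! i\<close>. It is needed for the one tree that is itself a path.\<close>

lemma laplacian_energy_cong: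
  assumes G: "pair_graph G" and H: "pair_graph H"
    and xs: "distinct xs" "set xs = pverts G" and ys: "distinct ys" "set ys = pverts H"
    and len: "length xs = length ys"
    and arcs: "\<And>i j. i < length xs \<Longrightarrow> j < length xs \<Longrightarrow>
      (xs ! i, xs ! j) \<in> parcs G \<longleftrightarrow> (ys ! i, ys ! j) \<in> parcs H"
  shows "laplacian_energy G = laplacian_energy H"
proof -
  have sumG: "(\<Sum>v\<in>pverts G. g v) = (\<Sum>k<length xs. g (xs ! k))" for g :: "'a \<Rightarrow> real"
    by (rule sum.reindex_bij_betw[symmetric]) (use bij_betw_nth[OF xs(1)] xs(2) in auto)
  have sumH: "(\<Sum>v\<in>pverts H. g v) = (\<Sum>k<length xs. g (ys ! k))" for g :: "'b \<Rightarrow> real"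
    by (rule sum.reindex_bij_betw[symmetric]) (use bij_betw_nth[OF ys(1)] ys(2) len in auto)
  have deg: "real (out_degree (with_proj G) (xs ! i)) = real (out_degree (with_proj H) (ys ! i))"
    if "i < length xs" for i
  proof -
    have "xs ! i \<in> pverts G" "ys ! i \<in> pverts H" using that xs(2) ys(2) len by auto
    then show ?thesis
      using that by (simp add: out_degree_eq_sum[OF G] out_degree_eq_sum[OF H] sumG sumH arcs cong: sum.cong_simp)
  qed
  have "laplacian_mat G xs = laplacian_mat H ys"
  proof (rule eq_matI)
    show "dim_row (laplacian_mat G xs) = dim_row (laplacian_mat H ys)"
      "dim_col (laplacian_mat G xs) = dim_col (laplacian_mat H ys)"
      using laplacian_mat_carrier[of G xs] laplacian_mat_carrier[of H ys] len by (metis carrier_matD)+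
    fix i j assume "i < dim_row (laplacian_mat H ys)" "j < dim_col (laplacian_mat H ys)"
    then have "i < length xs" "j < length xs" using laplacian_mat_carrier[of H ys] len by (metis carrier_matD)+
    then show "laplacian_mat G xs $$ (i, j) = laplacian_mat H ys $$ (i, j)"
      using len by (simp add: laplacian_mat_index deg arcs)
  qed
  then have "laplacian_spectrum G = laplacian_spectrum H"
    by (simp add: laplacian_spectrum_eq[OF xs] laplacian_spectrum_eq[OF ys])
  moreover have "average_degree G = average_degree H"
  proof -
    have "real (card (parcs G)) = (\<Sum>i<length xs. \<Sum>j<length xs. if (xs ! i, xs ! j) \<in> parcs G then 1 else 0)"
      using sum_parcs[OF G, of "\<lambda>_. 1 :: real"] by (simp add: sumG)
    also have "\<dots> = (\<Sum>i<length xs. \<Sum>j<length xs. if (ys ! i, ys ! j) \<in> parcs H then 1 else 0)"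
      by (intro sum.cong) (auto simp: arcs)
    also have "\<dots> = real (card (parcs H))"
      using sum_parcs[OF H, of "\<lambda>_. 1 :: real"] by (simp add: sumH)
    finally have "card (edge_set G) = card (edge_set H)"
      by (simp add: card_parcs_eq[OF G] card_parcs_eq[OF H])
    moreover have "card (pverts G) = card (pverts H)"
      using distinct_card[OF xs(1)] distinct_card[OF ys(1)] xs(2) ys(2) len by simp
    ultimately show ?thesis by (simp add: average_degree_def)
  qed
  ultimately show ?thesis by (simp add: laplacian_energy_def)
qed

section \<open>Paths\<close>

lemma pair_graph_path_graph: "pair_graph (path_graph n)"
proof -
  have "parcs (path_graph n) \<subseteq> {0..<n} \<times> {0..<n}" by (auto simp: path_graph_def)
  then have "finite (parcs (path_graph n))" by (rule finite_subset) simp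
  then show ?thesis
    by unfold_locales (auto simp: path_graph_def symmetric_def sym_def)
qed

lemma average_degree_path_graph:
  assumes "0 < n"
  shows "average_degree (path_graph n) = 2 - 2 / real n"
proof -
  have "edge_set (path_graph n) = (\<lambda>i. {i, Suc i}) ` {..<n - 1}"
    by (auto simp: edge_set_def path_graph_def image_iff less_diff_conv doubleton_eq_iff)
      (metis Suc_lessD)+
  moreover have "inj_on (\<lambda>i. {i, Suc i}) {..<n - 1}"
    by (auto simp: inj_on_def doubleton_eq_iff)
  ultimately have "card (edge_set (path_graph n)) = n - 1" by (simp add: card_image)
  then show ?thesis using assms
    by (simp add: average_degree_def path_graph_def of_nat_diff field_simps)
qed

lemma path_graph_neighbour_sum:
  fixes g :: "nat \<Rightarrow> real"
  assumes "i < n"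
  shows "(\<Sum>j<n. if (i, j) \<in> parcs (path_graph n) then g j else 0)
    = (if Suc i < n then g (Suc i) else 0) + (if 0 < i then g (i - 1) else 0)"
proof -
  have "(\<Sum>j<n. if (i, j) \<in> parcs (path_graph n) then g j else 0)
    = (\<Sum>j<n. (if j = Suc i then g j else 0) + (if j = i - 1 \<and> 0 < i then g j else 0))"
    using assms by (intro sum.cong) (auto simp: path_graph_def)
  also have "\<dots> = (if Suc i < n then g (Suc i) else 0) + (if 0 < i then g (i - 1) else 0)"
    using assms by (cases "i = 0") (auto simp: sum.distrib)
  finally show ?thesis .
qed

text \<open>The eigenvector is cos (\<theta> (j + 1/2)). The shift by 1/2 makes it symmetric about
  both ends of the path: continued to j = -1 and j = n, it repeats the values at 0 and n - 1. The
  missing neighbours at the ends therefore contribute 0, and every row reduces to cos (x + \<theta>)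
  + cos (x - \<theta>) = 2 cos \<theta> cos x.\<close>

lemma path_graph_eigenvalue:
  assumes k: "k < n"
  shows "eigenvalue (laplacian_mat (path_graph n) [0..<n]) (2 - 2 * cos (real k * pi / real n))"
proof -
  let ?G = "path_graph n"
  define \<theta> where "\<theta> = real k * pi / real n"
  define h where "h j = cos (\<theta> * (real j + 1 / 2))" for j
  let ?v = "vec n h"
  let ?A = "laplacian_mat ?G [0..<n]"
  have n: "0 < n" using k by simp
  have A: "?A \<in> carrier_mat n n" using laplacian_mat_carrier[of ?G "[0..<n]"] by simp
  have n\<theta>: "\<theta> * real n = real k * pi" using n by (simp add: \<theta>_def)
  have "?v $ 0 > 0"
  proof -
    have "\<theta> * (1 / 2) < pi / 2" using k n by (simp add: \<theta>_def field_simps)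
    moreover have "0 \<le> \<theta>" by (simp add: \<theta>_def)
    ultimately show ?thesis using n by (simp add: h_def cos_gt_zero_pi)
  qed
  then have "?v \<noteq> 0\<^sub>v n" using n by (metis index_zero_vec(1) less_irrefl)
  moreover have "?A *\<^sub>v ?v = (2 - 2 * cos \<theta>) \<cdot>\<^sub>v ?v"
  proof (rule eq_vecI)
    fix i assume "i < dim_vec ((2 - 2 * cos \<theta>) \<cdot>\<^sub>v ?v)"
    then have i: "i < n" by simp
    define x where "x = \<theta> * (real i + 1 / 2)"
    have "(?A *\<^sub>v ?v) $ i = (\<Sum>j<n. ?A $$ (i, j) * h j)"
      using i A by (auto simp: scalar_prod_def lessThan_atLeast0 intro!: sum.cong)
    also have "\<dots> = (\<Sum>j<n. (if i = j then real (out_degree (with_proj ?G) i) * h j else 0)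
        - (if (i, j) \<in> parcs ?G then h j else 0))"
      using i by (intro sum.cong) (auto simp: laplacian_mat_index algebra_simps)
    also have "\<dots> = real (out_degree (with_proj ?G) i) * h i
        - (\<Sum>j<n. if (i, j) \<in> parcs ?G then h j else 0)"
      using i by (simp add: sum_subtractf)
    also have "real (out_degree (with_proj ?G) i) = (\<Sum>j<n. if (i, j) \<in> parcs ?G then 1 else 0)"
    proof -
      have "pverts ?G = {..<n}" by (auto simp: path_graph_def)
      with out_degree_eq_sum[OF pair_graph_path_graph, of i n] i show ?thesis by simp
    qed
    finally have "(?A *\<^sub>v ?v) $ i = (if Suc i < n then h i - h (Suc i) else 0)
        + (if 0 < i then h i - h (i - 1) else 0)"
      using i by (cases "i = 0"; cases "Suc i < n") (simp_all add: path_graph_neighbour_sum algebra_simps)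
    moreover have "(if Suc i < n then h i - h (Suc i) else 0) = h i - cos (x + \<theta>)"
    proof (cases "Suc i < n")
      case True
      then show ?thesis by (simp add: h_def x_def algebra_simps)
    next
      case False
      then have "n = Suc i" using i by simp
      then have *: "x = real k * pi - \<theta> / 2" "x + \<theta> = real k * pi + \<theta> / 2"
        using n\<theta> by (simp_all add: x_def algebra_simps)
      have "cos (x + \<theta>) = cos x" unfolding * by (simp add: cos_add cos_diff)
      then show ?thesis using False by (simp add: h_def x_def)
    qed
    moreover have "(if 0 < i then h i - h (i - 1) else 0) = h i - cos (x - \<theta>)"
    proof (cases "i = 0")
      case True
      then have *: "x - \<theta> = - x" by (simp add: x_def)
      have "cos (x - \<theta>) = cos x" unfolding * by (rule cos_minus)
      with True show ?thesis by (simp add: h_def x_def)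
    next
      case False
      then have "\<theta> * (real (i - 1) + 1 / 2) = x - \<theta>"
        by (simp add: x_def of_nat_diff algebra_simps)
      with False show ?thesis by (simp add: h_def)
    qed
    moreover have "cos (x + \<theta>) + cos (x - \<theta>) = 2 * cos \<theta> * h i"
      by (simp add: cos_add cos_diff h_def x_def)
    ultimately show "(?A *\<^sub>v ?v) $ i = ((2 - 2 * cos \<theta>) \<cdot>\<^sub>v ?v) $ i"
      using i by (simp add: algebra_simps)
  qed (use A in auto)
  ultimately show ?thesis
    using A unfolding eigenvalue_def eigenvector_def \<theta>_def[symmetric] by (intro exI[of _ ?v]) auto
qed

text \<open>The n known eigenvalues are distinct, as cos is injective on [0, pi]; they form a
  submultiset of a spectrum of size n and hence exhaust it.\<close>

lemma laplacian_spectrum_path_graph: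
  "laplacian_spectrum (path_graph n)
    = image_mset (\<lambda>k. 2 - 2 * cos (real k * pi / real n)) (mset_set {..<n})"
proof -
  let ?G = "path_graph n" and ?\<mu> = "\<lambda>k. 2 - 2 * cos (real k * pi / real n)"
  let ?A = "laplacian_mat ?G [0..<n]"
  have A: "?A \<in> carrier_mat n n" using laplacian_mat_carrier[of ?G "[0..<n]"] by simp
  have sp: "laplacian_spectrum ?G = proots (char_poly ?A)"
    by (rule laplacian_spectrum_eq) (auto simp: path_graph_def)
  have inj: "inj_on ?\<mu> {..<n}"
  proof (rule inj_onI)
    fix i j assume ij: "i \<in> {..<n}" "j \<in> {..<n}" "?\<mu> i = ?\<mu> j"
    have bound: "0 \<le> real l * pi / real n" "real l * pi / real n \<le> pi" if "l < n" for l
      using that by (simp_all add: divide_le_eq mult.commute)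
    have "cos (real i * pi / real n) = cos (real j * pi / real n)" using ij(3) by simp
    then have "real i * pi / real n = real j * pi / real n"
      by (rule cos_inj_pi[rotated 4]) (use bound ij in simp_all)
    then show "i = j" using ij by auto
  qed
  have cp: "char_poly ?A \<noteq> 0" using degree_monic_char_poly[OF A] by auto
  have "?\<mu> ` {..<n} \<subseteq> set_mset (proots (char_poly ?A))"
    using path_graph_eigenvalue[of _ n] cp by (auto simp: eigenvalue_root_char_poly[OF A])
  then have "mset_set (?\<mu> ` {..<n}) \<subseteq># mset_set (set_mset (proots (char_poly ?A)))"
    by (intro subset_imp_msubset_mset_set) auto
  also have "\<dots> \<subseteq># proots (char_poly ?A)" by (rule mset_set_set_mset_msubset)
  finally have sub: "image_mset ?\<mu> (mset_set {..<n}) \<subseteq># laplacian_spectrum ?G"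
    by (simp add: image_mset_mset_set[OF inj] sp)
  have "size (laplacian_spectrum ?G) = n"
    by (simp add: size_laplacian_spectrum[OF pair_graph_path_graph]) (simp add: path_graph_def)
  moreover obtain N where "laplacian_spectrum ?G = image_mset ?\<mu> (mset_set {..<n}) + N"
    using sub by (auto simp: mset_subset_eq_exists_conv)
  ultimately show ?thesis by simp
qed

lemma laplacian_energy_path_graph:
  assumes "0 < n"
  shows "laplacian_energy (path_graph n) = (\<Sum>k<n. \<bar>2 / real n - 2 * cos (real k * pi / real n)\<bar>)"
proof -
  have "laplacian_energy (path_graph n) =
      (\<Sum>k<n. \<bar>2 - 2 * cos (real k * pi / real n) - (2 - 2 / real n)\<bar>)"
    by (simp add: laplacian_energy_def laplacian_spectrum_path_graph image_mset.compositionality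
        comp_def sum_unfold_sum_mset average_degree_path_graph[OF assms])
  then show ?thesis by (simp add: algebra_simps)
qed

text \<open>The Dirichlet kernel: after multiplication by 2 sin (\<alpha> / 2) each summand is a
  difference of two sines, and the sum telescopes.\<close>

lemma sum_cos_multiples:
  fixes \<alpha> :: real
  shows "2 * sin (\<alpha> / 2) * (\<Sum>k\<le>m. cos (real k * \<alpha>)) = sin ((real m + 1 / 2) * \<alpha>) + sin (\<alpha> / 2)"
proof (induction m)
  case 0
  then show ?case by simp
next
  case (Suc m)
  have "2 * sin (\<alpha> / 2) * cos (real (Suc m) * \<alpha>)
      = sin (real (Suc m) * \<alpha> + \<alpha> / 2) - sin (real (Suc m) * \<alpha> - \<alpha> / 2)"
    by (simp add: sin_add sin_diff)
  then show ?case using Suc by (simp add: algebra_simps)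
qed

section \<open>Numerical bounds for pi and for sine, cosine and cotangent on [0, 1]\<close>

lemma sin_ge_poly:
  fixes x :: real
  assumes "0 \<le> x"
  shows "x - x ^ 3 / 6 - x ^ 5 / 120 \<le> sin x" and "sin x \<le> x - x ^ 3 / 6 + x ^ 5 / 120"
proof -
  have "(\<Sum>m<5. sin_coeff m * x ^ m) = x - x ^ 3 / 6"
  proof -
    have "{..<5} = {0, 1, 2, 3, 4 :: nat}" by auto
    then show ?thesis by (simp add: sin_coeff_def fact_numeral)
  qed
  with Maclaurin_sin_bound[of x 5] assms
  have "\<bar>sin x - (x - x ^ 3 / 6)\<bar> \<le> x ^ 5 / 120"
    by (simp add: fact_numeral field_simps)
  then show "x - x ^ 3 / 6 - x ^ 5 / 120 \<le> sin x" "sin x \<le> x - x ^ 3 / 6 + x ^ 5 / 120"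
    by linarith+
qed

text \<open>For a smaller pi, the upper Taylor bound would force sin (pi / 6) below 1/2. The value
  3.14 suffices below because 4 / 3.14 < 1.274 and 1 / 3.14 < 8 / 25.\<close>

lemma pi_ge_314: "157 / 50 \<le> pi"
proof (rule ccontr)
  assume "\<not> ?thesis"
  then have "sin (pi / 6) \<le> sin (157 / 300)"
    using pi_ge_two by (intro sin_monotone_2pi_le) auto
  also have "\<dots> < 1 / 2"
    using sin_ge_poly(2)[of "157 / 300"] by (simp add: power_divide field_simps)
  finally show False by (simp add: sin_30)
qed

text \<open>On [0, 1] the quintic term is absorbed by the cubic one, since 1/6 + 1/120 <
  1/5.\<close>

lemma sin_ge_div:
  assumes "0 \<le> x" "x \<le> 1"
  shows "x - x ^ 3 / 5 \<le> sin (x :: real)"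
proof -
  have "x ^ 5 \<le> x ^ 3" using assms by (intro power_decreasing) auto
  moreover have "0 \<le> x ^ 3" using assms by simp
  ultimately show ?thesis using sin_ge_poly(1)[OF assms(1)] by linarith
qed

text \<open>The identity cos x = 1 - 2 sin^2 (x / 2) turns the lower bound for the sine into an
  upper bound for the cosine.\<close>

lemma cos_le_poly:
  assumes "0 \<le> x" "x \<le> 1"
  shows "cos x \<le> 1 - x\<^sup>2 / 2 + x ^ 4 / (20 :: real)"
proof -
  define y where "y = x / 2"
  have y: "0 \<le> y" "y \<le> 1" "x = 2 * y" using assms by (auto simp: y_def)
  have "0 \<le> y - y ^ 3 / 5"
    using y power_decreasing[of 1 3 y] by simp
  then have "(y - y ^ 3 / 5)\<^sup>2 \<le> (sin y)\<^sup>2"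
    using sin_ge_div[OF y(1,2)] by (intro power_mono)
  moreover have "y\<^sup>2 - 2 * y ^ 4 / 5 \<le> (y - y ^ 3 / 5)\<^sup>2"
  proof -
    have "(y - y ^ 3 / 5)\<^sup>2 = y\<^sup>2 - 2 * y ^ 4 / 5 + (y ^ 3 / 5)\<^sup>2"
      by (simp add: eval_nat_numeral algebra_simps)
    then show ?thesis by simp
  qed
  ultimately show ?thesis unfolding y(3) cos_double_sin by (simp add: power_mult_distrib)
qed

text \<open>Serves even n, where the energy of the path is 2 cot x with x = pi / (2 n). The constant
  8/25 must lie below the Taylor coefficient 1/3, and above 1 / pi so that the gain 16 x / 25 covers
  1 / n = 2 x / pi.\<close>

lemma cot_le:
  assumes "0 < x" "x \<le> 1"
  shows "cos x / sin x \<le> 1 / x - 8 * x / (25 :: real)"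
proof -
  define t where "t = x\<^sup>2"
  have t: "0 \<le> t" "t \<le> 1" using assms by (auto simp: t_def power_le_one)
  have s: "x * (1 - t / 6 - t\<^sup>2 / 120) \<le> sin x"
    using sin_ge_poly(1)[of x] assms by (simp add: t_def algebra_simps eval_nat_numeral)
  have sp: "0 < sin x" using assms pi_ge_314 by (intro sin_gt_zero) auto
  have "x * cos x \<le> x * (1 - t / 2 + t\<^sup>2 / 20)"
    using cos_le_poly[of x] assms by (intro mult_left_mono) (auto simp: t_def)
  also have "\<dots> \<le> x * ((1 - 8 * t / 25) * (1 - t / 6 - t\<^sup>2 / 120))"
  proof (rule mult_left_mono)
    have "0 \<le> t * ((1 / 75 - t / 200) + t\<^sup>2 / 375)"
      using t by (intro mult_nonneg_nonneg add_nonneg_nonneg) auto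
    then show "1 - t / 2 + t\<^sup>2 / 20 \<le> (1 - 8 * t / 25) * (1 - t / 6 - t\<^sup>2 / 120)"
      by (simp add: algebra_simps power2_eq_square)
  qed (use assms in auto)
  also have "\<dots> = (1 - 8 * t / 25) * (x * (1 - t / 6 - t\<^sup>2 / 120))" by simp
  also have "\<dots> \<le> (1 - 8 * t / 25) * sin x"
    using s t by (intro mult_left_mono) auto
  finally show ?thesis
    using assms sp by (simp add: field_simps t_def power2_eq_square)
qed

text \<open>Serves odd n, where the energy of the path is 2 / sin x - 2 / n. The constant 1/4 lies
  above the Taylor coefficient 1/6 and below 1 / pi, so that the excess x / 2 costs at most 1 /
  n.\<close>

lemma inverse_sin_le:
  assumes "0 < x" "x \<le> 1"
  shows "1 / sin x \<le> 1 / x + x / (4 :: real)"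
proof -
  define t where "t = x\<^sup>2"
  have t: "0 \<le> t" "t \<le> 1" using assms by (auto simp: t_def power_le_one)
  have s: "x * (1 - t / 5) \<le> sin x"
    using sin_ge_div[of x] assms by (simp add: t_def algebra_simps eval_nat_numeral)
  have sp: "0 < sin x" using assms pi_ge_314 by (intro sin_gt_zero) auto
  have "0 \<le> t * (1 - t)" using t by simp
  then have "1 \<le> (1 + t / 4) * (1 - t / 5)"
    by (simp add: algebra_simps power2_eq_square)
  then have "x * 1 \<le> x * ((1 + t / 4) * (1 - t / 5))"
    using assms by (intro mult_left_mono) auto
  also have "\<dots> = (1 + t / 4) * (x * (1 - t / 5))" by simp
  also have "\<dots> \<le> (1 + t / 4) * sin x" using s t by (intro mult_left_mono) auto
  finally show ?thesis using assms sp by (simp add: field_simps t_def power2_eq_square)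
qed

text \<open>The deviations from the average degree sum to 0, so the energy is twice the sum over k
  \<le> m, the range where the cosine exceeds 1 / n. The Dirichlet kernel evaluates this sum, and
  the parity of n decides whether its numerator is cos x or 1.\<close>

lemma laplacian_energy_path_graph_le:
  assumes n: "5 \<le> n"
  shows "laplacian_energy (path_graph n) \<le> 637 / 500 * real n - 1 / real n"
proof -
  define \<alpha> where "\<alpha> = pi / real n"
  define x where "x = \<alpha> / 2"
  define c where "c k = cos (real k * \<alpha>)" for k
  define m where "m = (n - 1) div 2"
  have n\<alpha>: "real n * \<alpha> = pi" using n by (simp add: \<alpha>_def)
  have \<alpha>: "0 < \<alpha>" using n by (simp add: \<alpha>_def)
  have nx: "real n = pi / (2 * x)" "1 / real n = 2 * x / pi" using n by (simp_all add: x_def \<alpha>_def)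
  have "pi / (2 * real n) \<le> 4 / (2 * 5)" using n pi_less_4 by (intro frac_le) auto
  then have x: "0 < x" "x \<le> 2 / 5" using n by (auto simp: x_def \<alpha>_def)
  have sx: "0 < sin x" using x pi_ge_314 by (intro sin_gt_zero) auto
  have csum: "(\<Sum>k\<le>j. c k) = (sin ((real j + 1 / 2) * \<alpha>) / sin x + 1) / 2" for j
    using sum_cos_multiples[of \<alpha> j] sx by (simp add: c_def x_def field_simps)
  \<comment> \<open>No cosine falls strictly between 0 and 1 / n: up to m they are at least sin x,
    which is at least 2 x / pi = 1 / n for x \<le> 2/5.\<close>
  have pos: "1 / real n \<le> c k" if k: "k \<le> m" for k
  proof -
    have "real k * \<alpha> \<le> pi / 2 - x"
    proof -
      have "2 * k + 1 \<le> n" using k n by (simp add: m_def)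
      then have "(2 * real k + 1) * \<alpha> \<le> real n * \<alpha>" using \<alpha> by (intro mult_right_mono) linarith+
      then show ?thesis unfolding n\<alpha> x_def by (simp add: algebra_simps)
    qed
    moreover have "pi / 2 - x \<le> pi" using x pi_gt_zero by linarith
    ultimately have "cos (pi / 2 - x) \<le> c k"
      unfolding c_def using \<alpha> x by (intro cos_monotone_0_pi_le) auto
    then have "sin x \<le> c k" by (simp add: sin_cos_eq)
    moreover have "x - x ^ 3 / 5 \<le> sin x" using x by (intro sin_ge_div) auto
    moreover have "2 * x / pi \<le> x - x ^ 3 / 5"
    proof -
      have "x * x \<le> 2 / 5 * (2 / 5)" using x by (intro mult_mono) auto
      moreover have "2 / pi \<le> 2 / (157 / 50)" using pi_ge_314 by (intro frac_le) auto
      ultimately have "x * (2 / pi) \<le> x * (1 - x * x / 5)" using x by (intro mult_left_mono) auto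
      then show ?thesis by (simp add: algebra_simps eval_nat_numeral)
    qed
    ultimately show ?thesis unfolding nx(2) by linarith
  qed
  have neg: "c k \<le> 0" if k: "m < k" "k < n" for k
  proof -
    have "n \<le> 2 * k" using k by (simp add: m_def)
    then have "real n * \<alpha> \<le> 2 * real k * \<alpha>" using \<alpha> by (intro mult_right_mono) linarith+
    moreover have "real k * \<alpha> \<le> real n * \<alpha>" using \<alpha> k by (intro mult_right_mono) linarith+
    ultimately have "cos (real k * \<alpha>) \<le> cos (pi / 2)"
      unfolding n\<alpha> by (intro cos_monotone_0_pi_le) auto
    then show ?thesis by (simp add: c_def)
  qed
  have mn: "m < n" using n by (simp add: m_def)
  have zero: "(\<Sum>k<n. 2 / real n - 2 * c k) = 0"
  proof -
    have "{..<n} = {..n - 1}" using n by auto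
    then have "(\<Sum>k<n. c k) = (sin ((real (n - 1) + 1 / 2) * \<alpha>) / sin x + 1) / 2"
      by (simp add: csum)
    also have "(real (n - 1) + 1 / 2) * \<alpha> = pi - x"
      using n n\<alpha> by (simp add: of_nat_diff x_def algebra_simps)
    finally have "(\<Sum>k<n. c k) = 1" using sx by simp
    then show ?thesis using n by (simp add: sum_subtractf flip: sum_distrib_left)
  qed
  have split: "(\<Sum>k<n. g k) = (\<Sum>k\<le>m. g k) + (\<Sum>k\<in>{m<..<n}. g k)" for g :: "nat \<Rightarrow> real"
    using mn by (subst sum.union_disjoint[symmetric]) (auto intro!: sum.cong)
  have "laplacian_energy (path_graph n) = (\<Sum>k<n. \<bar>2 / real n - 2 * c k\<bar>)"
    using n by (subst laplacian_energy_path_graph) (auto simp: c_def \<alpha>_def)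
  also have "\<dots> = (\<Sum>k\<le>m. 2 * c k - 2 / real n) + (\<Sum>k\<in>{m<..<n}. 2 / real n - 2 * c k)"
    unfolding split
  proof (intro arg_cong2[where f = "(+)"] sum.cong)
    fix k assume "k \<in> {..m}"
    then show "\<bar>2 / real n - 2 * c k\<bar> = 2 * c k - 2 / real n" using pos[of k] by simp
  next
    fix k assume "k \<in> {m<..<n}"
    then have "c k \<le> 0" "0 \<le> 2 / real n" using neg[of k] by auto
    then show "\<bar>2 / real n - 2 * c k\<bar> = 2 / real n - 2 * c k" by linarith
  qed auto
  also have "\<dots> = 2 * (\<Sum>k\<le>m. 2 * c k - 2 / real n)"
  proof -
    have "(\<Sum>k\<le>m. 2 / real n - 2 * c k) = - (\<Sum>k\<le>m. 2 * c k - 2 / real n)"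
      by (simp flip: sum_negf)
    then show ?thesis using zero unfolding split by linarith
  qed
  also have "\<dots> = 2 * (sin ((real m + 1 / 2) * \<alpha>) / sin x + 1 - 2 * real (m + 1) / real n)"
  proof -
    have "(\<Sum>k\<le>m. 2 * c k) = 2 * (\<Sum>k\<le>m. c k)" by (simp add: sum_distrib_left)
    then show ?thesis by (simp add: sum_subtractf csum)
  qed
  finally have LE: "laplacian_energy (path_graph n)
      = 2 * (sin ((real m + 1 / 2) * \<alpha>) / sin x + 1 - 2 * real (m + 1) / real n)" .
  have nb: "2 / x \<le> 637 / 500 * real n"
  proof -
    have "4 / pi \<le> 4 / (157 / 50)" using pi_ge_314 by (intro frac_le) auto
    then have "4 / pi * real n \<le> 637 / 500 * real n" by (intro mult_right_mono) auto
    then show ?thesis using x by (simp add: nx field_simps)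
  qed
  show ?thesis
  proof (cases "even n")
    case True
    then obtain q where "n = 2 * q" by blast
    then have m: "n = 2 * m + 2" using n by (auto simp: m_def)
    have "(real m + 1 / 2) * \<alpha> = pi / 2 - x"
      using n\<alpha> by (simp add: m x_def algebra_simps)
    then have "laplacian_energy (path_graph n) = 2 * (cos x / sin x)"
      unfolding LE using m by (simp add: sin_diff)
    also have "\<dots> \<le> 2 * (1 / x - 8 * x / 25)"
      using cot_le[of x] x by simp
    also have "\<dots> \<le> 2 / x - 1 / real n"
    proof -
      have "2 / pi \<le> 2 / (157 / 50)" using pi_ge_314 by (intro frac_le) auto
      then have "x * (2 / pi) \<le> x * (16 / 25)" using x by (intro mult_left_mono) auto
      then show ?thesis unfolding nx(2) by simp
    qed
    finally show ?thesis using nb by simp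
  next
    case False
    then obtain q where "n = 2 * q + 1" using oddE by blast
    then have m: "n = 2 * m + 1" by (auto simp: m_def)
    have angle: "(real m + 1 / 2) * \<alpha> = pi / 2"
      using n\<alpha> by (simp add: m algebra_simps)
    have "laplacian_energy (path_graph n) = 2 * (1 / sin x + 1 - 2 * real (m + 1) / real n)"
      unfolding LE angle by simp
    also have "\<dots> = 2 * (1 / sin x) - 2 / real n"
    proof -
      have "1 - 2 * real (m + 1) / real n = - (1 / real n)" using m by (simp add: field_simps)
      then have "2 * (1 / sin x) + 2 * (1 - 2 * real (m + 1) / real n) = 2 * (1 / sin x) + 2 * (- (1 / real n))"
        by (simp only:)
      then show ?thesis by (simp add: algebra_simps)
    qed
    also have "\<dots> \<le> 2 * (1 / x + x / 4) - 2 / real n"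
      using inverse_sin_le[of x] x by simp
    also have "\<dots> \<le> 2 / x - 1 / real n"
    proof -
      have "2 / 4 \<le> 2 / pi" using pi_less_4 by (intro frac_le) auto
      then have "x * (2 / 4) \<le> x * (2 / pi)" using x by (intro mult_left_mono) auto
      moreover have "2 / real n = 2 * (1 / real n)" by simp
      ultimately show ?thesis unfolding nx(2) by simp
    qed
    finally show ?thesis using nb by simp
  qed
qed

section \<open>Trees of diameter 4\<close>

definition level :: "'a rel \<Rightarrow> 'a \<Rightarrow> 'a \<Rightarrow> nat" where
  "level E c x = (LEAST k. (c, x) \<in> E ^^ k)"

text \<open>Acyclicity is stated through bridges because this form is refuted by mere reachability;
  no simple cycle has to be assembled in the arguments about levels.\<close>

locale rooted_forest =
  fixes E :: "'a rel" and c :: 'a and V :: "'a set"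
  assumes sym: "(x, y) \<in> E \<Longrightarrow> (y, x) \<in> E"
    and irrefl: "(x, x) \<notin> E"
    and bridge: "(x, y) \<in> E \<Longrightarrow> (y, x) \<notin> (E - {(x, y), (y, x)})\<^sup>*"
    and E_V: "(x, y) \<in> E \<Longrightarrow> x \<in> V"
    and reach: "x \<in> V \<Longrightarrow> (c, x) \<in> E\<^sup>*"
begin

abbreviation lev :: "'a \<Rightarrow> nat" where "lev \<equiv> level E c"

definition down :: "'a rel" where
  "down = {(x, y) \<in> E. lev y = Suc (lev x)}"

text \<open>The level bound is what shows that a path from the root misses a given edge with a
  deeper end.\<close>

definition down_upto :: "nat \<Rightarrow> 'a rel" where
  "down_upto k = {(x, y) \<in> down. lev y \<le> k}"

lemma relpow_lev: "x \<in> V \<Longrightarrow> (c, x) \<in> E ^^ lev x"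
  unfolding level_def using reach[of x] by (auto simp: rtrancl_power intro: LeastI_ex)

lemma lev_le: "(c, x) \<in> E ^^ k \<Longrightarrow> lev x \<le> k"
  unfolding level_def by (rule Least_le)

lemma lev_root: "lev c = 0"
  using lev_le[of c 0] by simp

lemma lev_eq_0: "x \<in> V \<Longrightarrow> lev x = 0 \<longleftrightarrow> x = c"
  using relpow_lev[of x] lev_root by auto

lemma lev_edge: "(x, y) \<in> E \<Longrightarrow> lev y \<le> Suc (lev x)"
  using relpow_lev[of x] E_V[of x y] by (intro lev_le) (auto intro: relpow_Suc_I)

lemma parent_exists:
  assumes "x \<in> V" "x \<noteq> c"
  shows "\<exists>y. (y, x) \<in> down"
proof -
  obtain k where k: "lev x = Suc k" using lev_eq_0 assms by (cases "lev x") auto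
  with relpow_lev[OF assms(1)] obtain y where y: "(c, y) \<in> E ^^ k" "(y, x) \<in> E"
    by (auto elim: relpow_Suc_E)
  with lev_le[of y k] lev_edge[of y x] k have "lev y = k" by simp
  with y k show ?thesis by (auto simp: down_def)
qed

lemma reach_down_upto:
  assumes "x \<in> V" "lev x \<le> k"
  shows "(c, x) \<in> (down_upto k)\<^sup>*"
  using assms
proof (induction "lev x" arbitrary: x rule: less_induct)
  case less
  show ?case
  proof (cases "x = c")
    case False
    then obtain y where y: "(y, x) \<in> down" using parent_exists less.prems by blast
    then have "y \<in> V" "lev y < lev x" by (auto simp: down_def dest: E_V)
    with less have "(c, y) \<in> (down_upto k)\<^sup>*" by simp
    moreover have "(y, x) \<in> down_upto k" using y less.prems by (simp add: down_upto_def)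
    ultimately show ?thesis by (rule rtrancl_into_rtrancl)
  qed simp
qed

lemma reach_back_avoiding:
  assumes "x \<in> V" "lev x \<le> k" and F: "\<And>u v. (u, v) \<in> down_upto k \<Longrightarrow> (v, u) \<in> F"
  shows "(x, c) \<in> F\<^sup>*"
proof -
  have "(down_upto k)\<inverse> \<subseteq> F" using F by auto
  then have "((down_upto k)\<inverse>)\<^sup>* \<subseteq> F\<^sup>*" by (rule rtrancl_mono)
  then show ?thesis using reach_down_upto[OF assms(1,2)] by (auto simp: rtrancl_converse)
qed

lemma reach_avoiding:
  assumes "x \<in> V" "lev x \<le> k" and F: "\<And>u v. (u, v) \<in> down_upto k \<Longrightarrow> (u, v) \<in> F"
  shows "(c, x) \<in> F\<^sup>*"
proof -
  have "down_upto k \<subseteq> F" using F by auto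
  then show ?thesis using reach_down_upto[OF assms(1,2)] rtrancl_mono by blast
qed

text \<open>Otherwise both ends are joined to the root by arcs that change the level. Those arcs
  avoid the edge, which contradicts that it is a bridge.\<close>

lemma lev_neq:
  assumes xy: "(x, y) \<in> E"
  shows "lev x \<noteq> lev y"
proof
  assume eq: "lev x = lev y"
  let ?F = "E - {(x, y), (y, x)}"
  have V: "x \<in> V" "y \<in> V" using xy E_V sym by blast+
  have "(y, c) \<in> ?F\<^sup>*"
    by (rule reach_back_avoiding[OF V(2) order_refl]) (use eq sym in \<open>auto simp: down_upto_def down_def\<close>)
  moreover have "(c, x) \<in> ?F\<^sup>*"
    by (rule reach_avoiding[OF V(1) order_refl]) (use eq in \<open>auto simp: down_upto_def down_def\<close>)
  ultimately show False using bridge[OF xy] by (meson rtrancl_trans)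
qed

text \<open>A second parent z opens the detour from y over z and the root to x. Beyond the arc from
  y to z it uses only arcs with both ends at level at most \<open>lev x\<close>, so it avoids the
  edge between x and y.\<close>

lemma parent_unique:
  assumes xy: "(x, y) \<in> down" and zy: "(z, y) \<in> down"
  shows "x = z"
proof (rule ccontr)
  assume ne: "x \<noteq> z"
  let ?F = "E - {(x, y), (y, x)}"
  let ?k = "lev x"
  have E: "(x, y) \<in> E" "(z, y) \<in> E" and l: "lev y = Suc ?k" "lev z = ?k"
    using xy zy by (auto simp: down_def)
  have V: "x \<in> V" "z \<in> V" using E E_V by blast+
  have "(y, z) \<in> ?F" using E ne sym irrefl by auto
  moreover have "(z, c) \<in> ?F\<^sup>*"
    by (rule reach_back_avoiding[OF V(2), of ?k]) (use l sym in \<open>auto simp: down_upto_def down_def\<close>)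
  moreover have "(c, x) \<in> ?F\<^sup>*"
    by (rule reach_avoiding[OF V(1), of ?k]) (use l in \<open>auto simp: down_upto_def down_def\<close>)
  ultimately have "(y, x) \<in> ?F\<^sup>*" by (meson rtrancl_trans converse_rtrancl_into_rtrancl)
  then show False using bridge[OF E(1)] by contradiction
qed

lemma edge_cases: "(x, y) \<in> E \<Longrightarrow> (x, y) \<in> down \<or> (y, x) \<in> down"
  using lev_edge[of x y] lev_edge[of y x] lev_neq[of x y] sym[of x y] by (auto simp: down_def)

lemma descendant_parent:
  assumes "(a, y) \<in> down\<^sup>*" "y \<noteq> a" "(x, y) \<in> down"
  shows "(a, x) \<in> down\<^sup>*"
  using assms parent_unique by (metis rtranclE)

lemma lev_descendant: "(a, y) \<in> down\<^sup>* \<Longrightarrow> lev a \<le> lev y \<and> (lev a = lev y \<longrightarrow> a = y)"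
  by (induction rule: rtrancl_induct) (auto simp: down_def)

lemma descendant_same_level:
  assumes "(a, x) \<in> down\<^sup>*" "(b, x) \<in> down\<^sup>*" "lev a = lev b"
  shows "a = b"
  using assms
proof (induction rule: rtrancl_induct)
  case base
  then show ?case using lev_descendant[of b a] by simp
next
  case (step y z)
  have "lev b < lev z" using lev_descendant[OF step(1)] step by (auto simp: down_def)
  then have "(b, y) \<in> down\<^sup>*" using descendant_parent[OF step.prems(1) _ step(2)] by auto
  then show ?case using step by blast
qed

text \<open>Count levels negatively in the subtree below a and positively elsewhere. This signed
  level grows by at most 1 along an edge, and it differs by \<open>lev u + lev w\<close> between u
  and w.\<close>

lemma dist_through_root:
  assumes a: "lev a = 1" and u: "(a, u) \<in> down\<^sup>*" and w: "(a, w) \<notin> down\<^sup>*"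
    and uw: "(u, w) \<in> E ^^ k"
  shows "lev u + lev w \<le> k"
proof -
  define f where "f x = (if (a, x) \<in> down\<^sup>* then - int (lev x) else int (lev x))" for x
  have step: "f y \<le> f x + 1" if xy: "(x, y) \<in> E" for x y
  proof -
    have l: "int (lev y) \<le> int (lev x) + 1" "int (lev x) \<le> int (lev y) + 1"
      using lev_edge[OF xy] lev_edge[OF sym[OF xy]] by auto
    \<comment> \<open>The only edge leaving the subtree joins a to the root, where the signed level
      takes the values -1 and 0.\<close>
    have cross: "x = a \<and> lev y = 0" if "(a, x) \<in> down\<^sup>*" "(a, y) \<notin> down\<^sup>*" "(x, y) \<in> E" for x y
    proof -
      have "(y, x) \<in> down" using edge_cases[OF that(3)] that by (meson rtrancl_into_rtrancl)
      moreover from this have "x = a" using descendant_parent[OF that(1)] that(2) by blast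
      ultimately show ?thesis using a by (auto simp: down_def)
    qed
    show ?thesis
      using l cross[of x y] cross[of y x] xy sym[OF xy] a by (auto simp: f_def)
  qed
  have "f y \<le> f x + int j" if "(x, y) \<in> E ^^ j" for x y j
    using that
  proof (induction j arbitrary: y)
    case (Suc j)
    then obtain z where "(x, z) \<in> E ^^ j" "(z, y) \<in> E" by (auto elim: relpow_Suc_E)
    with Suc.IH[of z] step[of z y] show ?case by simp
  qed simp
  from this[OF uw] show ?thesis using u w by (simp add: f_def)
qed

end

text \<open>The sets \<open>L x\<close> may be empty; such an x is a leaf attached to the
  centre.\<close>

locale two_level_tree =
  fixes G :: "'a pair_pre_digraph" and c :: 'a and C :: "'a set" and L :: "'a \<Rightarrow> 'a set"
  assumes graph: "pair_graph G"
    and verts: "pverts G = insert c (C \<union> (\<Union>x\<in>C. L x))"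
    and arcs: "(u, v) \<in> parcs G \<longleftrightarrow> u = c \<and> v \<in> C \<or> v = c \<and> u \<in> C
      \<or> u \<in> C \<and> v \<in> L u \<or> v \<in> C \<and> u \<in> L v"
    and c_notin_C: "c \<notin> C"
    and c_notin_L: "x \<in> C \<Longrightarrow> c \<notin> L x"
    and L_disjoint_C: "x \<in> C \<Longrightarrow> L x \<inter> C = {}"
    and L_disjoint: "x \<in> C \<Longrightarrow> y \<in> C \<Longrightarrow> x \<noteq> y \<Longrightarrow> L x \<inter> L y = {}"

section \<open>Walks, distances and bridges\<close>

lemma awalk_iff_relpow:
  assumes "pair_graph G" "u \<in> pverts G"
  shows "(\<exists>p. pre_digraph.awalk (with_proj G) u p v \<and> length p = k) \<longleftrightarrow> (u, v) \<in> parcs G ^^ k"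
  using assms(2)
proof (induction k arbitrary: u)
  interpret pair_graph G by fact
  \<comment> \<open>The empty walk exists only at a vertex, whereas \<open>^^ 0\<close> relates
    everything to itself; membership of u in the vertex set enters here.\<close>
  case 0
  then show ?case by (auto simp: awalk_Nil_iff)
next
  interpret pair_graph G by fact
  case (Suc k)
  have "(\<exists>p. awalk u p v \<and> length p = Suc k)
      \<longleftrightarrow> (\<exists>w. (u, w) \<in> parcs G \<and> (\<exists>p. awalk w p v \<and> length p = k))"
    (is "?l = ?r")
  proof
    assume ?l
    then obtain e p where "awalk u (e # p) v" "length p = k" by (metis length_Suc_conv)
    then show ?r by (intro exI[of _ "snd e"]) (auto simp: awalk_Cons_iff)
  next
    assume ?r
    then obtain w p where "(u, w) \<in> parcs G" "awalk w p v" "length p = k" by blast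
    then show ?l by (intro exI[of _ "(u, w) # p"]) (simp add: awalk_Cons_iff)
  qed
  also have "\<dots> \<longleftrightarrow> (\<exists>w. (u, w) \<in> parcs G \<and> (w, v) \<in> parcs G ^^ k)"
    using Suc.IH in_arcsD2 by metis
  also have "\<dots> \<longleftrightarrow> (u, v) \<in> parcs G ^^ Suc k"
    by (meson relpow_Suc_I2 relpow_Suc_D2)
  finally show ?case .
qed

lemma graph_dist_le_iff:
  assumes "pair_graph G" "u \<in> pverts G"
  shows "graph_dist G u v \<le> ereal (real k) \<longleftrightarrow> (\<exists>j\<le>k. (u, v) \<in> parcs G ^^ j)"
proof -
  interpret pair_graph G by fact
  have cost: "awalk_cost (\<lambda>_. 1) p = real (length p)" for p :: "('a \<times> 'a) list"
    by (induction p) auto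
  show ?thesis
  proof
    assume "graph_dist G u v \<le> ereal (real k)"
    \<comment> \<open>A strict bound by k + 1 produces a walk below the infimum's bound without
      knowing that the infimum is attained; its length is an integer, hence at most k.\<close>
    also have "\<dots> < ereal (real (Suc k))" by simp
    finally obtain p where "awalk u p v" "real (length p) < real (Suc k)"
      unfolding graph_dist_def \<mu>_def by (auto simp: INF_less_iff cost)
    then show "\<exists>j\<le>k. (u, v) \<in> parcs G ^^ j"
      using awalk_iff_relpow[OF assms, of v "length p"] by (intro exI[of _ "length p"]) auto
  next
    assume "\<exists>j\<le>k. (u, v) \<in> parcs G ^^ j"
    then obtain j where j: "j \<le> k" "(u, v) \<in> parcs G ^^ j" by auto
    with awalk_iff_relpow[OF assms, of v j] obtain p where p: "awalk u p v" "length p \<le> k" by auto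
    have "graph_dist G u v \<le> ereal (awalk_cost (\<lambda>_. 1) p)"
      unfolding graph_dist_def by (rule min_cost_le_walk_cost[OF p(1)])
    also have "\<dots> \<le> ereal (real k)" using p by (simp add: cost)
    finally show "graph_dist G u v \<le> ereal (real k)" .
  qed
qed

text \<open>A simple path from y back to x closes up with the arc (x, y) to a cycle. It has at least
  two arcs, since x and y differ and the arc (y, x) is excluded, so the cycle has length at least
  3.\<close>

lemma acyclic_edge_is_bridge:
  assumes G: "pair_graph G" and nc: "\<not> (\<exists>p. pre_digraph.cycle (with_proj G) p \<and> 3 \<le> length p)"
    and xy: "(x, y) \<in> parcs G"
  shows "(y, x) \<notin> (parcs G - {(x, y), (y, x)})\<^sup>*"
proof
  interpret pair_graph G by fact
  define F where "F = parcs G - {(x, y), (y, x)}"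
  assume "(y, x) \<in> (parcs G - {(x, y), (y, x)})\<^sup>*"
  then have "(y, x) \<in> F\<^sup>*" by (simp add: F_def)
  then have "\<exists>p. awalk y p x \<and> set p \<subseteq> F"
  proof (induction rule: rtrancl_induct)
    case base
    then show ?case using xy in_arcsD2 by (intro exI[of _ "[]"]) (auto simp: awalk_Nil_iff)
  next
    case (step z w)
    from step(3) obtain p where p: "awalk y p z" "set p \<subseteq> F" by (elim exE conjE)
    have "(z, w) \<in> parcs G" using step(2) by (simp add: F_def)
    then have "awalk z [(z, w)] w" using in_arcsD2 by (simp add: awalk_simps)
    then have "awalk y (p @ [(z, w)]) w" using p(1) by auto
    then show ?case using p(2) step(2) by (intro exI[of _ "p @ [(z, w)]"]) auto
  qed
  then obtain p where p: "awalk y p x" "set p \<subseteq> F" by blast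
  define q where "q = awalk_to_apath p"
  have q: "apath y q x" "set q \<subseteq> F"
    using apath_awalk_to_apath[OF p(1)] awalk_to_apath_subset[OF p(1)] p(2) by (auto simp: q_def)
  have "x \<noteq> y" using no_loops' xy by blast
  then have "2 \<le> length q"
    using q unfolding F_def by (cases q rule: remdups_adj.cases) (auto simp: apath_def awalk_simps)
  moreover have "cycle ((x, y) # q)"
    unfolding cycle_def using q(1) xy
    by (intro exI[of _ x]) (auto simp: apath_def awalk_Cons_iff)
  ultimately show False using nc by fastforce
qed

text \<open>The centre c is the midpoint of a walk u, a, c, b, v between vertices at distance 4. No
  vertex w lies below both a and b, so w is separated from u or from v by the root; this gives 2 +
  \<open>lev w\<close> \<le> 4.\<close>

lemma diameter_four_two_level_tree:
  assumes T: "tree_graph T" and diam: "graph_diameter T = 4"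
  obtains c C L a b where "two_level_tree T c C L"
    "a \<in> C" "b \<in> C" "a \<noteq> b" "L a \<noteq> {}" "L b \<noteq> {}"
proof -
  have G: "pair_graph T" and nc: "\<not> (\<exists>p. pre_digraph.cycle (with_proj T) p \<and> 3 \<le> length p)"
    using T by (auto simp: tree_graph_def)
  interpret pair_graph T by fact
  let ?E = "parcs T"
  have dist4: "\<exists>j\<le>4. (u, v) \<in> ?E ^^ j" if "u \<in> pverts T" "v \<in> pverts T" for u v
  proof -
    have "graph_dist T u v \<le> graph_diameter T"
      unfolding graph_diameter_def using that by (intro SUP_upper2[of u] SUP_upper2[of v]) auto
    then show ?thesis using graph_dist_le_iff[OF G that(1), of v 4] diam by simp
  qed
  have "\<exists>u\<in>pverts T. \<exists>v\<in>pverts T. \<not> graph_dist T u v \<le> ereal (real 3)"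
  proof (rule ccontr)
    assume "\<not> ?thesis"
    then have "graph_diameter T \<le> ereal (real 3)"
      unfolding graph_diameter_def by (intro SUP_least) auto
    then show False using diam by simp
  qed
  then obtain u v where uv: "u \<in> pverts T" "v \<in> pverts T" and far: "\<not> (\<exists>j\<le>3. (u, v) \<in> ?E ^^ j)"
    using graph_dist_le_iff[OF G, of _ _ 3] by blast
  have "(u, v) \<in> ?E ^^ 4"
  proof -
    obtain j where j: "j \<le> 4" "(u, v) \<in> ?E ^^ j" using dist4[OF uv] by blast
    with far have "j = 4" by (metis le_neq_implies_less less_Suc_eq_le eval_nat_numeral(2) semiring_norm(26,27) numeral_3_eq_3 Suc_numeral)
    with j show ?thesis by simp
  qed
  then obtain a c b where e: "(u, a) \<in> ?E" "(a, c) \<in> ?E" "(c, b) \<in> ?E" "(b, v) \<in> ?E"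
    by (auto simp: eval_nat_numeral relcomp_unfold)
  have E: "?E ^^ 0 = Id" "?E ^^ 1 = ?E" "?E ^^ 2 = ?E O ?E" "?E ^^ 3 = ?E O ?E O ?E"
    by (auto simp: eval_nat_numeral)
  have far': "(u, v) \<notin> ?E ^^ j" if "j \<le> 3" for j using far that by blast
  have symm: "(x, y) \<in> ?E \<Longrightarrow> (y, x) \<in> ?E" for x y by (rule arcs_symmetric)
  have irr: "(x, x) \<notin> ?E" for x using no_loops' by blast
  have cV: "c \<in> pverts T" using e(3) in_arcsD1 by blast
  interpret R: rooted_forest ?E c "pverts T"
  proof
    show "(c, x) \<in> ?E\<^sup>*" if "x \<in> pverts T" for x
      using dist4[OF cV that] by (auto simp: rtrancl_power)
  qed (auto simp: symm irr acyclic_edge_is_bridge[OF G nc] dest: in_arcsD1)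
  have ab: "a \<noteq> b" using far'[of 2] e unfolding E by auto
  have lev1: "R.lev x = 1 \<longleftrightarrow> (c, x) \<in> ?E" if "x \<in> pverts T" for x
  proof
    assume "R.lev x = 1"
    then show "(c, x) \<in> ?E" using R.relpow_lev[OF that] by simp
  next
    assume "(c, x) \<in> ?E"
    then show "R.lev x = 1" using R.lev_edge[of c x] R.lev_neq[of c x] R.lev_root by simp
  qed
  have la: "R.lev a = 1" and lb: "R.lev b = 1"
    using lev1 e symm in_arcsD1 in_arcsD2 by blast+
  have lu: "R.lev u = 2"
  proof -
    have "R.lev u \<le> 2" using R.lev_edge[OF symm[OF e(1)]] la by simp
    moreover have "R.lev u \<noteq> 1" using la R.lev_neq[OF e(1)] by simp
    moreover have "R.lev u \<noteq> 0"
      using far'[of 2] e unfolding E R.lev_eq_0[OF uv(1)] by auto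
    ultimately show ?thesis by linarith
  qed
  have lv: "R.lev v = 2"
  proof -
    have "R.lev v \<le> 2" using R.lev_edge[OF e(4)] lb by simp
    moreover have "R.lev v \<noteq> 1" using lb R.lev_neq[OF e(4)] by simp
    moreover have "R.lev v \<noteq> 0"
      using far'[of 2] e unfolding E R.lev_eq_0[OF uv(2)] by auto
    ultimately show ?thesis by linarith
  qed
  have au: "(a, u) \<in> R.down\<^sup>*" and bv: "(b, v) \<in> R.down\<^sup>*"
    using la lb lu lv e symm by (auto simp: R.down_def)
  have lev2: "R.lev w \<le> 2" if w: "w \<in> pverts T" for w
  proof -
    have *: "R.lev w \<le> 2" if d: "R.lev d = 1" and z: "R.lev z = 2" "(d, z) \<in> R.down\<^sup>*" "z \<in> pverts T"
      and dw: "(d, w) \<notin> R.down\<^sup>*" for d z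
    proof -
      obtain j where "j \<le> 4" "(z, w) \<in> ?E ^^ j" using dist4[OF z(3) w] by blast
      with R.dist_through_root[OF d z(2) dw] z(1) show ?thesis by fastforce
    qed
    have "(a, w) \<notin> R.down\<^sup>* \<or> (b, w) \<notin> R.down\<^sup>*"
      using R.descendant_same_level[of a w b] la lb ab by auto
    then show ?thesis using *[OF la lu au uv(1)] *[OF lb lv bv uv(2)] by blast
  qed
  define C where "C = {x. (c, x) \<in> ?E}"
  define L where "L x = {y. (x, y) \<in> ?E \<and> y \<noteq> c}" for x
  have C_lev: "x \<in> pverts T \<and> R.lev x = 1" if "x \<in> C" for x
    using that lev1[of x] in_arcsD2 by (auto simp: C_def)
  have L_lev: "y \<in> pverts T \<and> R.lev y = 2 \<and> (x, y) \<in> R.down" if "x \<in> C" "y \<in> L x" for x y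
  proof -
    have xy: "(x, y) \<in> ?E" "y \<noteq> c" and y: "y \<in> pverts T"
      using that in_arcsD2 by (auto simp: L_def)
    have "R.lev y \<noteq> 1" using R.lev_neq[OF xy(1)] C_lev[OF that(1)] by simp
    moreover have "R.lev y \<noteq> 0" using R.lev_eq_0[OF y] xy by simp
    ultimately have "R.lev y = 2" using lev2[OF y] by linarith
    then show ?thesis using y xy C_lev[OF that(1)] by (simp add: R.down_def)
  qed
  have down_cases: "x = c \<and> y \<in> C \<or> x \<in> C \<and> y \<in> L x" if "(x, y) \<in> R.down" for x y
  proof -
    have xy: "(x, y) \<in> ?E" "R.lev y = Suc (R.lev x)" using that by (auto simp: R.down_def)
    have V: "x \<in> pverts T" "y \<in> pverts T" using xy in_arcsD1 in_arcsD2 by blast+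
    have "R.lev x = 0 \<or> R.lev x = 1" using lev2[OF V(2)] xy(2) by linarith
    then show ?thesis
      using xy R.lev_eq_0[OF V(1)] R.lev_eq_0[OF V(2)] lev1[OF V(1)] by (auto simp: C_def L_def)
  qed
  have "two_level_tree T c C L"
  proof
    show "pverts T = insert c (C \<union> (\<Union>x\<in>C. L x))"
    proof
      show "pverts T \<subseteq> insert c (C \<union> (\<Union>x\<in>C. L x))"
        using R.parent_exists down_cases by blast
      show "insert c (C \<union> (\<Union>x\<in>C. L x)) \<subseteq> pverts T"
        using cV C_lev L_lev by blast
    qed
    show "(x, y) \<in> ?E \<longleftrightarrow> x = c \<and> y \<in> C \<or> y = c \<and> x \<in> C
      \<or> x \<in> C \<and> y \<in> L x \<or> y \<in> C \<and> x \<in> L y" for x y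
      using R.edge_cases[of x y] down_cases[of x y] down_cases[of y x] symm[of x y] symm[of y x]
      by (auto simp: C_def L_def)
    show "c \<notin> C" using irr by (simp add: C_def)
    show "c \<notin> L x" for x by (simp add: L_def)
    show "L x \<inter> C = {}" if "x \<in> C" for x using L_lev[OF that] C_lev by fastforce
    show "L x \<inter> L y = {}" if "x \<in> C" "y \<in> C" "x \<noteq> y" for x y
      using L_lev that R.parent_unique by blast
  qed
  moreover have "a \<in> C" "b \<in> C" using e symm by (auto simp: C_def)
  moreover have "u \<in> L a" "v \<in> L b"
    using e symm lu lv R.lev_root by (auto simp: L_def)
  ultimately show ?thesis using that ab by blast
qed

section \<open>Lower bounds for the energy of two-level trees\<close>

context two_level_tree
begin

abbreviation s :: "'a \<Rightarrow> nat" where "s x \<equiv> card (L x)"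

lemma finite_C: "finite C" and finite_L: "x \<in> C \<Longrightarrow> finite (L x)"
proof -
  interpret pair_graph G by (rule graph)
  have "C \<subseteq> pverts G" "x \<in> C \<Longrightarrow> L x \<subseteq> pverts G" for x using verts by auto
  then show "finite C" "x \<in> C \<Longrightarrow> finite (L x)" using pair_finite_verts finite_subset by blast+
qed

lemma sum_verts:
  fixes g :: "'a \<Rightarrow> 'b::comm_monoid_add"
  shows "(\<Sum>v\<in>pverts G. g v) = g c + (\<Sum>x\<in>C. g x + (\<Sum>y\<in>L x. g y))"
proof -
  have "c \<notin> C \<union> (\<Union>x\<in>C. L x)" using c_notin_C c_notin_L by blast
  moreover have "C \<inter> (\<Union>x\<in>C. L x) = {}" using L_disjoint_C by blast
  moreover have "(\<Sum>y\<in>(\<Union>x\<in>C. L x). g y) = (\<Sum>x\<in>C. \<Sum>y\<in>L x. g y)"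
    using finite_C finite_L L_disjoint by (intro sum.UNION_disjoint) auto
  ultimately show ?thesis
    using finite_C finite_L by (simp add: verts sum.union_disjoint sum.distrib)
qed

lemma sum_arcs:
  fixes g :: "'a \<Rightarrow> 'a \<Rightarrow> real"
  assumes g: "\<And>u v. g u v = g v u"
  shows "(\<Sum>(u, v)\<in>parcs G. g u v) = 2 * (\<Sum>x\<in>C. g c x + (\<Sum>y\<in>L x. g x y))"
proof -
  define F where "F = Pair c ` C \<union> Sigma C L"
  have "(u, v) \<in> parcs G \<longleftrightarrow> (u, v) \<in> F \<union> F\<inverse>" for u v
    unfolding arcs by (auto simp: F_def)
  then have E: "parcs G = F \<union> F\<inverse>" by auto
  have disj: "F \<inter> F\<inverse> = {}"
    using c_notin_C c_notin_L L_disjoint_C by (auto simp: F_def)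
  have fin: "finite F" using finite_C finite_L by (auto simp: F_def)
  have "(\<Sum>(u, v)\<in>F\<inverse>. g u v) = (\<Sum>(u, v)\<in>F. g u v)"
    by (rule sum.reindex_bij_witness[of _ prod.swap prod.swap]) (auto simp: g)
  then have "(\<Sum>(u, v)\<in>parcs G. g u v) = 2 * (\<Sum>(u, v)\<in>F. g u v)"
    using fin disj by (simp add: E sum.union_disjoint)
  also have "(\<Sum>(u, v)\<in>F. g u v) = (\<Sum>(u, v)\<in>Pair c ` C. g u v) + (\<Sum>(u, v)\<in>Sigma C L. g u v)"
    unfolding F_def using finite_C finite_L c_notin_C by (intro sum.union_disjoint) auto
  also have "(\<Sum>(u, v)\<in>Pair c ` C. g u v) = (\<Sum>x\<in>C. g c x)"
    by (subst sum.reindex) (auto simp: inj_on_def)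
  also have "(\<Sum>(u, v)\<in>Sigma C L. g u v) = (\<Sum>x\<in>C. \<Sum>y\<in>L x. g x y)"
    using finite_C finite_L by (simp add: sum.Sigma)
  finally show ?thesis by (simp add: sum.distrib)
qed

lemma card_verts: "card (pverts G) = 1 + card C + (\<Sum>x\<in>C. s x)"
  using sum_verts[of "\<lambda>_. 1 :: nat"] by (simp add: sum_Suc)

lemma average_degree: "average_degree G = 2 - 2 / real (card (pverts G))"
proof -
  have "real (card (parcs G)) = 2 * real (card C + (\<Sum>x\<in>C. s x))"
    using sum_arcs[of "\<lambda>_ _. 1"] by (simp add: sum.distrib)
  then have "real (card (edge_set G)) = real (card C + (\<Sum>x\<in>C. s x))"
    by (simp add: card_parcs_eq[OF graph])
  moreover have "real (card (pverts G)) = 1 + real (card C + (\<Sum>x\<in>C. s x))"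
    by (simp add: card_verts)
  ultimately show ?thesis unfolding average_degree_def by (simp add: field_simps)
qed

text \<open>Test functions with value \<open>a\<close> at the centre, \<open>b x\<close> at \<open>x \<in> C\<close> and \<open>e x\<close> on the leaves at \<open>x\<close>.\<close>

lemma laplacian_energy_ge_class_frame:
  fixes a :: "'i \<Rightarrow> real" and b e :: "'i \<Rightarrow> 'a \<Rightarrow> real"
  assumes I: "finite I"
    and orth: "\<And>i j. i \<in> I \<Longrightarrow> j \<in> I \<Longrightarrow> i \<noteq> j \<Longrightarrow>
      a i * a j + (\<Sum>x\<in>C. b i x * b j x + real (s x) * (e i x * e j x)) = 0"
    and pos: "\<And>i. i \<in> I \<Longrightarrow> 0 < (a i)\<^sup>2 + (\<Sum>x\<in>C. (b i x)\<^sup>2 + real (s x) * (e i x)\<^sup>2)"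
  shows "2 * (\<Sum>i\<in>I. (\<Sum>x\<in>C. (a i - b i x)\<^sup>2 + real (s x) * (b i x - e i x)\<^sup>2)
        / ((a i)\<^sup>2 + (\<Sum>x\<in>C. (b i x)\<^sup>2 + real (s x) * (e i x)\<^sup>2))
      - (2 - 2 / real (card (pverts G)))) \<le> laplacian_energy G"
proof -
  define f where "f i v = (if v = c then a i else if v \<in> C then b i v
    else e i (THE x. x \<in> C \<and> v \<in> L x))" for i v
  have fc: "f i c = a i" for i by (simp add: f_def)
  have fb: "f i x = b i x" if "x \<in> C" for i x
    using that c_notin_C by (auto simp: f_def)
  have fe: "f i y = e i x" if "x \<in> C" "y \<in> L x" for i x y
  proof -
    have "(THE x. x \<in> C \<and> y \<in> L x) = x"
      using that L_disjoint by (intro the_equality) auto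
    moreover have "y \<noteq> c" "y \<notin> C" using that c_notin_L L_disjoint_C by auto
    ultimately show ?thesis by (simp add: f_def)
  qed
  have ip: "(\<Sum>v\<in>pverts G. f i v * f j v)
      = a i * a j + (\<Sum>x\<in>C. b i x * b j x + real (s x) * (e i x * e j x))" for i j
    by (simp add: sum_verts fc fb fe)
  have nrm: "(\<Sum>v\<in>pverts G. (f i v)\<^sup>2)
      = (a i)\<^sup>2 + (\<Sum>x\<in>C. (b i x)\<^sup>2 + real (s x) * (e i x)\<^sup>2)" for i
    by (simp add: sum_verts fc fb fe)
  have dir: "(\<Sum>(u, v)\<in>parcs G. (f i u - f i v)\<^sup>2) / 2
      = (\<Sum>x\<in>C. (a i - b i x)\<^sup>2 + real (s x) * (b i x - e i x)\<^sup>2)" for i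
    by (subst sum_arcs) (simp_all add: power2_commute fc fb fe)
  show ?thesis
    using laplacian_energy_ge_frame[OF graph I, of f, unfolded ip nrm dir average_degree] orth pos
    by blast
qed

text \<open>The supports are disjoint, so orthogonality is immediate. On x and its s leaves the
  Laplacian block has top eigenvalue \<lambda> with \<lambda>^2 - (s + 2) \<lambda> + 1 = 0, close
  to s + 2, and its eigenvector has the ratio -(\<lambda> - 1) between x and a leaf; rounding this
  ratio gives s + 1 against -1.\<close>

lemma laplacian_energy_ge_star_frame:
  defines "B \<equiv> {x \<in> C. L x \<noteq> {}}"
  shows "2 * (real (card C) + (\<Sum>x\<in>B. (real (s x + 1)^2 + real (s x) * real (s x + 2)^2)
        / (real (s x + 1)^2 + real (s x)))
      - real (card B + 1) * (2 - 2 / real (card (pverts G)))) \<le> laplacian_energy G"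
proof -
  let ?d = "2 - 2 / real (card (pverts G))"
  define a where "a i = (if i = c then 1 else 0 :: real)" for i
  define b where "b i x = (if i = x then real (s x + 1) else 0)" for i x
  define e where "e i x = (if i = x then -1 else 0 :: real)" for i x :: 'a
  let ?Q = "\<lambda>i. \<Sum>x\<in>C. (a i - b i x)\<^sup>2 + real (s x) * (b i x - e i x)\<^sup>2"
  let ?N = "\<lambda>i. (a i)\<^sup>2 + (\<Sum>x\<in>C. (b i x)\<^sup>2 + real (s x) * (e i x)\<^sup>2)"
  have B: "finite B" "B \<subseteq> C" "c \<notin> B" using finite_C c_notin_C by (auto simp: B_def)
  have ac: "a c = 1" "b c x = 0" "e c x = 0" if "x \<in> C" for x
    using that c_notin_C by (auto simp: a_def b_def e_def)
  have Qc: "?Q c = real (card C)" and Nc: "?N c = 1"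
    by (simp_all add: ac a_def)
  have Qx: "?Q x = real (s x + 1)^2 + real (s x) * real (s x + 2)^2"
    and Nx: "?N x = real (s x + 1)^2 + real (s x)" if x: "x \<in> C" for x
  proof -
    have "?Q x = (\<Sum>y\<in>C. if y = x then real (s x + 1)^2 + real (s x) * real (s x + 2)^2 else 0)"
      using x c_notin_C by (intro sum.cong) (auto simp: a_def b_def e_def power2_eq_square algebra_simps)
    then show "?Q x = real (s x + 1)^2 + real (s x) * real (s x + 2)^2"
      using x finite_C by simp
    have "?N x = 0 + (\<Sum>y\<in>C. if y = x then real (s x + 1)^2 + real (s x) else 0)"
      using x c_notin_C by (intro arg_cong2[where f = "(+)"] sum.cong) (auto simp: a_def b_def e_def)
    then show "?N x = real (s x + 1)^2 + real (s x)" using x finite_C by simp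
  qed
  have "2 * (\<Sum>i\<in>insert c B. ?Q i / ?N i - ?d) \<le> laplacian_energy G"
  proof (rule laplacian_energy_ge_class_frame)
    show "finite (insert c B)" using B by simp
    fix i assume i: "i \<in> insert c B"
    show "0 < ?N i"
    proof (cases "i = c")
      case False
      then have "i \<in> C" using i B by auto
      then show ?thesis unfolding Nx[OF \<open>i \<in> C\<close>] by (simp add: add_pos_nonneg)
    qed (simp only: Nc zero_less_one)
    fix j assume j: "j \<in> insert c B" "i \<noteq> j"
    have "a i * a j = 0" using j by (auto simp: a_def)
    moreover have "b i x * b j x + real (s x) * (e i x * e j x) = 0" for x
      using j(2) by (auto simp: b_def e_def)
    ultimately show "a i * a j + (\<Sum>x\<in>C. b i x * b j x + real (s x) * (e i x * e j x)) = 0"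
      by (simp only: sum.neutral_const add_0)
  qed
  also have "(\<Sum>i\<in>insert c B. ?Q i / ?N i - ?d) = (?Q c / ?N c - ?d) + (\<Sum>x\<in>B. ?Q x / ?N x - ?d)"
    using B by simp
  also have "(\<Sum>x\<in>B. ?Q x / ?N x - ?d) = (\<Sum>x\<in>B. (real (s x + 1)^2 + real (s x) * real (s x + 2)^2)
        / (real (s x + 1)^2 + real (s x)) - ?d)"
  proof (rule sum.cong[OF refl])
    fix x assume "x \<in> B"
    then have x: "x \<in> C" using B by auto
    show "?Q x / ?N x - ?d = (real (s x + 1)^2 + real (s x) * real (s x + 2)^2)
        / (real (s x + 1)^2 + real (s x)) - ?d" unfolding Qx[OF x] Nx[OF x] ..
  qed
  finally show ?thesis unfolding Qc Nc sum_subtractf sum_constant by (simp add: algebra_simps add_divide_distrib)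
qed

text \<open>Equality holds for m = 1 and m = 2: the excess over m is 8/5 and 19/11 = 8/5 +
  7/55.\<close>

lemma star_rayleigh_ge:
  assumes "1 \<le> (m :: nat)"
  shows "real m + 8 / 5 + (if 2 \<le> m then 7 / 55 else 0)
    \<le> (real (m + 1)^2 + real m * real (m + 2)^2) / (real (m + 1)^2 + real m)"
proof (cases "2 \<le> m")
  case True
  define r where "r = real m - 2"
  have r: "0 \<le> r" "real m = r + 2" using True by (auto simp: r_def)
  have "0 < real (m + 1)^2 + real m" using r by (intro add_nonneg_pos) auto
  moreover have "(19 / 11 + real m) * (real (m + 1)^2 + real m)
      \<le> real (m + 1)^2 + real m * real (m + 2)^2"
  proof -
    have "real (m + 1)^2 + real m * real (m + 2)^2 - (19 / 11 + real m) * (real (m + 1)^2 + real m)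
        = r * (3 * r + 10) / 11"
      using r by (simp add: power2_eq_square field_simps)
    moreover have "0 \<le> r * (3 * r + 10) / 11" using r by simp
    ultimately show ?thesis by linarith
  qed
  ultimately show ?thesis using True by (simp add: le_divide_eq)
next
  case False
  then have "m = 1" using assms by simp
  then show ?thesis by simp
qed

text \<open>The leaf counts cancel because \<open>card C\<close> and the \<open>s x\<close> add up
  to n - 1, so the bound sees the tree only through n, q and t.\<close>

lemma laplacian_energy_ge_count:
  defines "q \<equiv> card {x \<in> C. 1 \<le> s x}" and "t \<equiv> card {x \<in> C. 2 \<le> s x}"
    and "n \<equiv> card (pverts G)"
  shows "2 * (real n - 3 - 2 / 5 * real q + 7 / 55 * real t + 2 * real (q + 1) / real n)
    \<le> laplacian_energy G"
proof -
  define B where "B = {x \<in> C. L x \<noteq> {}}"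
  have s1: "L x \<noteq> {} \<longleftrightarrow> 1 \<le> s x" if "x \<in> C" for x
    using finite_L[OF that] by (simp add: Suc_le_eq card_gt_0_iff)
  have B: "finite B" "B \<subseteq> C" "B = {x \<in> C. 1 \<le> s x}" using finite_C s1 by (auto simp: B_def)
  have "(\<Sum>x\<in>C. s x) = (\<Sum>x\<in>B. s x)"
    using B finite_C s1 by (intro sum.mono_neutral_right) auto
  then have n: "real n = 1 + real (card C) + (\<Sum>x\<in>B. real (s x))"
    by (simp add: n_def card_verts)
  have "(\<Sum>x\<in>B. real (s x) + 8 / 5 + (if 2 \<le> s x then 7 / 55 else 0))
      = (\<Sum>x\<in>B. real (s x)) + 8 / 5 * real q + 7 / 55 * real t"
  proof -
    have "B \<inter> {x. 2 \<le> s x} = {x \<in> C. 2 \<le> s x}" using B(3) by auto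
    then show ?thesis using B by (simp add: sum.distrib sum.If_cases q_def t_def)
  qed
  moreover have "(\<Sum>x\<in>B. real (s x) + 8 / 5 + (if 2 \<le> s x then 7 / 55 else 0))
      \<le> (\<Sum>x\<in>B. (real (s x + 1)^2 + real (s x) * real (s x + 2)^2) / (real (s x + 1)^2 + real (s x)))"
    using B(3) by (intro sum_mono star_rayleigh_ge) auto
  moreover have "card B = q" using B by (simp add: q_def)
  moreover have "n \<noteq> 0" by (simp add: n_def card_verts)
  ultimately show ?thesis
    using laplacian_energy_ge_star_frame[folded B_def n_def] n
    by (simp add: right_diff_distrib)
qed

end

text \<open>A test function is encoded as \<open>(a, ps, l)\<close>: the value \<open>a\<close> at the centre, for the \<open>j\<close>-th
  selected branch the pair \<open>ps ! j\<close> of its values at the branch vertex and on its leaves, and the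
  value \<open>l\<close> on the remaining neighbours of the centre, which are leaves of the tree.\<close>

type_synonym branch_function = "real \<times> (real \<times> real) list \<times> real"

fun branch_inner :: "nat list \<Rightarrow> nat \<Rightarrow> branch_function \<Rightarrow> branch_function \<Rightarrow> real" where
  "branch_inner ss k (a, ps, l) (a', ps', l') = a * a' + real k * (l * l')
     + (\<Sum>j<length ss. fst (ps ! j) * fst (ps' ! j) + real (ss ! j) * (snd (ps ! j) * snd (ps' ! j)))"

fun branch_dirichlet :: "nat list \<Rightarrow> nat \<Rightarrow> branch_function \<Rightarrow> real" where
  "branch_dirichlet ss k (a, ps, l) = real k * (a - l)\<^sup>2
     + (\<Sum>j<length ss. (a - fst (ps ! j))\<^sup>2 + real (ss ! j) * (fst (ps ! j) - snd (ps ! j))\<^sup>2)"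

context two_level_tree
begin

text \<open>The shape of the tree as plain numbers, so that inner products of explicit families
  become numeral arithmetic.\<close>

definition has_branches :: "nat list \<Rightarrow> nat \<Rightarrow> bool" where
  "has_branches ss k \<longleftrightarrow> (\<exists>xs. distinct xs \<and> set xs \<subseteq> C \<and> (\<forall>x\<in>C - set xs. s x = 0)
     \<and> card (C - set xs) = k \<and> map s xs = ss)"

lemma sum_branches:
  fixes g :: "'a \<Rightarrow> 'b::comm_monoid_add"
  assumes "distinct xs" "set xs \<subseteq> C"
  shows "(\<Sum>x\<in>C. g x) = (\<Sum>j<length xs. g (xs ! j)) + (\<Sum>x\<in>C - set xs. g x)"
proof -
  have "(\<Sum>x\<in>C. g x) = (\<Sum>x\<in>set xs. g x) + (\<Sum>x\<in>C - set xs. g x)"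
    using finite_C assms(2) by (metis add.commute sum.subset_diff)
  also have "(\<Sum>x\<in>set xs. g x) = (\<Sum>j<length xs. g (xs ! j))"
    by (rule sum.reindex_bij_betw[symmetric]) (use bij_betw_nth[OF assms(1)] in auto)
  finally show ?thesis .
qed

lemma card_verts_branches:
  assumes "has_branches ss k"
  shows "card (pverts G) = 1 + length ss + k + sum_list ss"
proof -
  obtain xs where xs: "distinct xs" "set xs \<subseteq> C" and rest: "\<forall>x\<in>C - set xs. s x = 0"
    and k: "card (C - set xs) = k" and ss: "map s xs = ss"
    using assms unfolding has_branches_def by blast
  have lss: "length ss = length xs" using ss by auto
  have "card C = length ss + k"
    using sum_branches[OF xs, of "\<lambda>_. 1 :: nat"] by (simp add: k lss)
  moreover have "(\<Sum>x\<in>C. s x) = sum_list ss"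
    using sum_branches[OF xs, of s] rest
    by (simp add: sum_list_sum_nth lss lessThan_atLeast0 flip: ss)
  ultimately show ?thesis by (simp add: card_verts)
qed

lemma laplacian_energy_ge_branch_frame:
  assumes br: "has_branches ss k"
    and vs: "\<forall>v\<in>set vs. length (fst (snd v)) = length ss \<and> 0 < branch_inner ss k v v"
    and orth: "sorted_wrt (\<lambda>v w. branch_inner ss k v w = 0) vs"
  shows "2 * (\<Sum>v\<leftarrow>vs. branch_dirichlet ss k v / branch_inner ss k v v
      - (2 - 2 / real (1 + length ss + k + sum_list ss))) \<le> laplacian_energy G"
proof -
  obtain xs where xs: "distinct xs" "set xs \<subseteq> C" and rest: "\<forall>x\<in>C - set xs. s x = 0"
    and k: "card (C - set xs) = k" and ss: "map s xs = ss"
    using br unfolding has_branches_def by blast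
  define a where "a i = fst (vs ! i)" for i
  define p where "p i = fst (snd (vs ! i))" for i
  define l where "l i = snd (snd (vs ! i))" for i
  have vsi: "vs ! i = (a i, p i, l i)" for i by (simp add: a_def p_def l_def)
  \<comment> \<open>The default leaf value 0 is harmless: outside xs there are no leaves below
    x.\<close>
  define h where "h i x = (case map_of (zip xs (p i)) x of Some be \<Rightarrow> be | None \<Rightarrow> (l i, 0))" for i x
  have lss: "length ss = length xs" using ss by auto
  have h: "h i (xs ! j) = p i ! j" if "i < length vs" "j < length xs" for i j
  proof -
    have "length (p i) = length xs" using vs that(1) by (simp add: p_def lss)
    then show ?thesis using that xs(1) by (simp add: h_def map_of_zip_nth)
  qed
  have h': "h i x = (l i, 0)" if "x \<notin> set xs" for i x
  proof -
    have "map_of (zip xs (p i)) x = None" using that by (auto simp: map_of_eq_None_iff dest: set_zip_leftD)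
    then show ?thesis by (simp add: h_def)
  qed
  have sx: "s (xs ! j) = ss ! j" if "j < length xs" for j using ss that by auto
  have ip: "a i * a j + (\<Sum>x\<in>C. fst (h i x) * fst (h j x) + real (s x) * (snd (h i x) * snd (h j x)))
      = branch_inner ss k (vs ! i) (vs ! j)" if "i < length vs" "j < length vs" for i j
    using that by (simp add: vsi sum_branches[OF xs] h h' sx lss rest k)
  have ip': "(a i)\<^sup>2 + (\<Sum>x\<in>C. (fst (h i x))\<^sup>2 + real (s x) * (snd (h i x))\<^sup>2)
      = branch_inner ss k (vs ! i) (vs ! i)" if "i < length vs" for i
    using ip[OF that that] by (simp add: power2_eq_square)
  have dir: "(\<Sum>x\<in>C. (a i - fst (h i x))\<^sup>2 + real (s x) * (fst (h i x) - snd (h i x))\<^sup>2)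
      = branch_dirichlet ss k (vs ! i)" if "i < length vs" for i
    using that by (simp add: vsi sum_branches[OF xs] h h' sx lss rest k)
  have comm: "branch_inner ss k v w = branch_inner ss k w v" for v w
    by (cases v; cases w) (simp add: mult_ac)
  have orth': "branch_inner ss k (vs ! i) (vs ! j) = 0"
    if "i < length vs" "j < length vs" "i \<noteq> j" for i j
    using orth comm[of "vs ! i" "vs ! j"] that
    unfolding sorted_wrt_iff_nth_less by (cases "j < i") auto
  let ?d = "2 - 2 / real (card (pverts G))"
  have "2 * (\<Sum>i<length vs. (\<Sum>x\<in>C. (a i - fst (h i x))\<^sup>2 + real (s x) * (fst (h i x) - snd (h i x))\<^sup>2)
        / ((a i)\<^sup>2 + (\<Sum>x\<in>C. (fst (h i x))\<^sup>2 + real (s x) * (snd (h i x))\<^sup>2)) - ?d)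
      \<le> laplacian_energy G"
  proof (rule laplacian_energy_ge_class_frame[of _ a "\<lambda>i x. fst (h i x)" "\<lambda>i x. snd (h i x)"])
    show "finite {..<length vs}" by simp
    fix i assume "i \<in> {..<length vs}"
    then have i: "i < length vs" by simp
    show "0 < (a i)\<^sup>2 + (\<Sum>x\<in>C. (fst (h i x))\<^sup>2 + real (s x) * (snd (h i x))\<^sup>2)"
      unfolding ip'[OF i] using vs i by simp
    fix j assume "j \<in> {..<length vs}" "i \<noteq> j"
    then have j: "j < length vs" "i \<noteq> j" by simp_all
    show "a i * a j + (\<Sum>x\<in>C. fst (h i x) * fst (h j x) + real (s x) * (snd (h i x) * snd (h j x))) = 0"
      unfolding ip[OF i j(1)] by (rule orth'[OF i j])
  qed
  also have "(\<Sum>i<length vs. (\<Sum>x\<in>C. (a i - fst (h i x))\<^sup>2 + real (s x) * (fst (h i x) - snd (h i x))\<^sup>2)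
        / ((a i)\<^sup>2 + (\<Sum>x\<in>C. (fst (h i x))\<^sup>2 + real (s x) * (snd (h i x))\<^sup>2)) - ?d)
      = (\<Sum>i<length vs. branch_dirichlet ss k (vs ! i) / branch_inner ss k (vs ! i) (vs ! i) - ?d)"
    by (intro sum.cong refl) (simp only: lessThan_iff dir ip')
  also have "\<dots> = (\<Sum>v\<leftarrow>vs. branch_dirichlet ss k v / branch_inner ss k v v - ?d)"
    by (simp add: sum_list_sum_nth lessThan_atLeast0)
  finally show ?thesis by (simp only: card_verts_branches[OF br])
qed

lemma branches_exist:
  assumes ab: "a \<in> C" "b \<in> C" "a \<noteq> b" "L a \<noteq> {}" "L b \<noteq> {}"
  obtains ss k where "has_branches ss k" "sorted_wrt (\<ge>) ss" "\<forall>m\<in>set ss. 1 \<le> m" "2 \<le> length ss"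
    "length ss = card {x \<in> C. 1 \<le> s x}" "length (filter (\<lambda>m. 2 \<le> m) ss) = card {x \<in> C. 2 \<le> s x}"
proof -
  define B where "B = {x \<in> C. 1 \<le> s x}"
  have fB: "finite B" using finite_C by (simp add: B_def)
  then obtain ys where ys: "set ys = B" "distinct ys" using finite_distinct_list by blast
  \<comment> \<open>Decreasing leaf counts give one list per shape, which keeps the list of
    exceptions short.\<close>
  define xs where "xs = rev (sort_key s ys)"
  have xs: "set xs = B" "distinct xs" using ys by (simp_all add: xs_def)
  have srt: "sorted_wrt (\<ge>) (map s xs)"
    using sorted_sort_key[of s ys] by (simp add: xs_def rev_map[symmetric] sorted_wrt_rev)
  have br: "has_branches (map s xs) (card (C - set xs))"
    unfolding has_branches_def
  proof (intro exI[of _ xs] conjI refl)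
    show "distinct xs" "set xs \<subseteq> C" using xs by (auto simp: B_def)
    show "\<forall>x\<in>C - set xs. s x = 0" unfolding xs(1) B_def by (simp add: not_less_eq_eq)
  qed
  have pos: "\<forall>m\<in>set (map s xs). 1 \<le> m" using xs by (auto simp: B_def)
  have lq: "length (map s xs) = card B"
    using xs distinct_card[of xs] by simp
  have two: "2 \<le> length (map s xs)"
  proof -
    have "{a, b} \<subseteq> B"
      using ab finite_L by (auto simp: B_def Suc_le_eq card_gt_0_iff)
    then have "card {a, b} \<le> card B" using fB by (intro card_mono)
    then show ?thesis using ab lq by simp
  qed
  have lt: "length (filter (\<lambda>m. 2 \<le> m) (map s xs)) = card {x \<in> C. 2 \<le> s x}"
  proof -
    have "length (filter (\<lambda>m. 2 \<le> m) (map s xs)) = length (filter (\<lambda>x. 2 \<le> s x) xs)"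
      by (simp add: filter_map comp_def)
    also have "\<dots> = card (set (filter (\<lambda>x. 2 \<le> s x) xs))"
      using xs by (intro distinct_card[symmetric]) simp
    also have "set (filter (\<lambda>x. 2 \<le> s x) xs) = {x \<in> C. 2 \<le> s x}"
      unfolding set_filter xs(1) B_def by (intro Collect_cong) (auto intro: order_trans[of 1 2])
    finally show ?thesis .
  qed
  show ?thesis by (rule that[OF br srt pos two lq[unfolded B_def] lt])
qed

text \<open>Each family roughly spans the eigenvectors with eigenvalue above the average
  degree.\<close>

lemma laplacian_energy_ge_exceptional:
  assumes br: "has_branches ss k" and ex: "(ss, k) \<in> {([2, 1], 0), ([1, 1], 1), ([3, 1], 0), ([2, 2], 0),
      ([1, 1, 1], 0), ([2, 1], 1), ([1, 1], 2), ([2, 1, 1], 0), ([1, 1, 1], 1), ([1, 1], 3), ([1, 1, 1, 1], 0)}"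
  shows "637 / 500 * real (card (pverts G)) - 1 / real (card (pverts G)) \<le> laplacian_energy G"
proof -
  note bound = laplacian_energy_ge_branch_frame[OF br]
  note n = card_verts_branches[OF br]
  from ex consider "ss = [2, 1]" "k = 0" | "ss = [1, 1]" "k = 1" | "ss = [3, 1]" "k = 0"
    | "ss = [2, 2]" "k = 0" | "ss = [1, 1, 1]" "k = 0" | "ss = [2, 1]" "k = 1" | "ss = [1, 1]" "k = 2"
    | "ss = [2, 1, 1]" "k = 0" | "ss = [1, 1, 1]" "k = 1" | "ss = [1, 1]" "k = 3"
    | "ss = [1, 1, 1, 1]" "k = 0"
    by auto
  then show ?thesis
  proof cases
    case 1
    show ?thesis
      using bound[of "[(3, [(-3, 1), (-2, 1)], 0), (1, [(2, -1), (-2, 1)], 0)]"] n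
      by (simp add: 1)
  next
    case 2
    show ?thesis
      using bound[of "[(2, [(-1, 0), (-1, 0)], -1), (0, [(2, -1), (-2, 1)], 0),
        (1, [(2, -2), (2, -2)], -2)]"] n
      by (simp add: 2)
  next
    case 3
    show ?thesis
      using bound[of "[(0, [(2, -1), (-1, 0)], 0), (2, [(-1, 0), (-2, 1)], 0)]"] n
      by (simp add: 3)
  next
    case 4
    show ?thesis
      using bound[of "[(2, [(-2, 1), (-2, 1)], 0), (0, [(2, -1), (-2, 1)], 0)]"] n
      by (simp add: 4)
  next
    \<comment> \<open>Equal branches: besides a rounded symmetric function, the family consists of
      the contrasts (1, -1, 0) and (1, 1, -2) between branches times (2, -1). The pair (2, -1)
      approximates the top eigenvector of a branch with one leaf, whose eigenvalue is (3 + sqrt 5) /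
      2. Case 11 extends this to four branches.\<close>
    case 5
    show ?thesis
      using bound[of "[(7, [(-3, 1), (-3, 1), (-3, 1)], 0), (0, [(2, -1), (-2, 1), (0, 0)], 0),
        (0, [(2, -1), (2, -1), (-4, 2)], 0)]"] n
      by (simp add: 5)
  next
    case 6
    show ?thesis
      using bound[of "[(2, [(-2, 1), (-1, 0)], -1), (2, [(2, -1), (-1, 0)], -1),
        (1, [(0, 0), (2, -2)], 0)]"] n
      by (simp add: 6)
  next
    case 7
    show ?thesis
      using bound[of "[(2, [(-1, 0), (-1, 0)], -1), (0, [(2, -1), (-2, 1)], 0),
        (1, [(2, -2), (2, -2)], -1)]"] n
      by (simp add: 7)
  next
    case 8
    show ?thesis
      using bound[of "[(2, [(-2, 1), (0, 0), (-2, 1)], 0), (2, [(2, -1), (-2, 0), (-1, 0)], 0),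
        (1, [(-2, 0), (-2, 1), (2, -2)], 0)]"] n
      by (simp add: 8)
  next
    case 9
    show ?thesis
      using bound[of "[(12, [(-4, 1), (-4, 1), (-4, 1)], -3), (0, [(2, -1), (-2, 1), (0, 0)], 0),
        (0, [(2, -1), (2, -1), (-4, 2)], 0), (1, [(1, -1), (1, -1), (1, -1)], -1)]"] n
      by (simp add: 9)
  next
    case 10
    show ?thesis
      using bound[of "[(2, [(-1, 0), (-1, 0)], 0), (2, [(2, -1), (2, -1)], -1),
        (0, [(2, -1), (-2, 1)], 0)]"] n
      by (simp add: 10)
  next
    case 11
    show ?thesis
      using bound[of "[(3, [(-1, 0), (-1, 0), (-1, 0), (-1, 0)], 0),
        (0, [(2, -1), (-2, 1), (0, 0), (0, 0)], 0), (0, [(2, -1), (2, -1), (-4, 2), (0, 0)], 0),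
        (0, [(2, -1), (2, -1), (2, -1), (-6, 3)], 0)]"] n
      by (simp add: 11)
  qed
qed
end

section \<open>Finite case analysis and conclusion\<close>

lemma branch_count_bound:
  assumes sorted: "sorted_wrt (\<ge>) ss" and pos: "\<forall>m\<in>set ss. 1 \<le> m" and two: "2 \<le> length ss"
    and n: "n = 1 + length ss + k + sum_list ss"
    and t: "t = length (filter (\<lambda>m. 2 \<le> m) ss)"
    and bad: "637 / 500 * real n - 1 / real n
      > 2 * (real n - 3 - 2 / 5 * real (length ss) + 7 / 55 * real t + 2 * real (length ss + 1) / real n)"
  shows "(ss, k) \<in> {([1, 1], 0), ([2, 1], 0), ([1, 1], 1), ([3, 1], 0), ([2, 2], 0),
      ([1, 1, 1], 0), ([2, 1], 1), ([1, 1], 2), ([2, 1, 1], 0), ([1, 1, 1], 1), ([1, 1], 3), ([1, 1, 1, 1], 0)}"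
proof -
  define q where "q = length ss"
  \<comment> \<open>Every branch has at least one leaf; the resulting q \<le> (n - 1) / 2 is the
    only control on the term that lowers the bound.\<close>
  have "length ss \<le> sum_list ss"
    using pos by (induction ss) auto
  then have qn: "2 * q + 1 \<le> n" using n by (simp add: q_def)
  have n5: "5 \<le> n" using qn two by (simp add: q_def)
  have n10: "n \<le> 10"
  proof (rule ccontr)
    assume "\<not> n \<le> 10"
    then have n11: "11 \<le> real n" by simp
    \<comment> \<open>The bound falls linearly in q with this slope, so the extreme value q = (n -
      1) / 2 is the worst case.\<close>
    have "real q * (4 / 5 - 4 / real n) \<le> (real n - 1) / 2 * (4 / 5 - 4 / real n)"
      using qn n11 by (intro mult_right_mono) (auto simp: field_simps)
    moreover have "(real n - 1) / 2 * (4 / 5 - 4 / real n) = 2 / 5 * real n - 12 / 5 + 2 / real n"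
      using n11 by (simp add: field_simps)
    moreover have "2 * (real n - 3 - 2 / 5 * real q + 7 / 55 * real t + 2 * real (q + 1) / real n)
        = 2 * real n - 6 - real q * (4 / 5 - 4 / real n) + 14 / 55 * real t + 4 / real n"
      by (simp add: algebra_simps add_divide_distrib)
    moreover have "0 \<le> real t" "0 \<le> 1 / real n" by simp_all
    moreover have "1 / real n = 2 / real n - 1 / real n" "4 / real n = 2 / real n + 2 / real n" by simp_all
    moreover have "4 / real n \<ge> 0" by simp
    ultimately have "1.6 * real n - 3.6 + 2 / real n < 637 / 500 * real n - 1 / real n"
      using bad unfolding q_def[symmetric] by linarith
    then have "163 / 500 * real n + 3 / real n < 18 / 5" by (simp add: field_simps)
    \<comment> \<open>At n = 10 the left side would be 3.56 and fail; that case survives because n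
      is even, which forces q \<le> 4.\<close>
    moreover have "163 / 500 * 11 + 3 / 11 > (18 / 5 :: real)" by simp
    moreover have "163 / 500 * real n + 3 / real n \<ge> 163 / 500 * 11 + 3 / 11"
    proof -
      define r where "r = real n - 11"
      have r: "0 \<le> r" "real n = r + 11" using n11 by (auto simp: r_def)
      have "3 / 11 - 3 / (r + 11) = 3 * r / (11 * (r + 11))" using r by (simp add: field_simps)
      also have "\<dots> \<le> 3 * r / 121" using r by (intro frac_le) auto
      also have "\<dots> \<le> 163 / 500 * r" using r by simp
      finally show ?thesis unfolding r(2) by argo
    qed
    ultimately show False by linarith
  qed
  from n5 n10 consider "n = 5" | "n = 6" | "n = 7" | "n = 8" | "n = 9" | "n = 10" by linarith
  note n_cases = this
  have "q \<le> 4" using qn n10 by simp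
  with two consider "q = 2" | "q = 3" | "q = 4" unfolding q_def by linarith
  then show ?thesis
  proof cases
    case 1
    then obtain x y where ss: "ss = [x, y]" by (auto simp: q_def numeral_2_eq_2 length_Suc_conv)
    then have xy: "y \<le> x" "1 \<le> y" "n = 3 + k + x + y" using sorted pos n by auto
    have t: "t = (if 2 \<le> x then 1 else 0) + (if 2 \<le> y then 1 else 0)" using t ss by simp
    show ?thesis
      using n_cases
    proof cases
      case 1
      then have "x = 1 \<and> y = 1 \<and> k = 0" using xy by linarith
      then show ?thesis using ss by simp
    next
      case 2
      then have "x = 2 \<and> y = 1 \<and> k = 0 \<or> x = 1 \<and> y = 1 \<and> k = 1" using xy by linarith
      then show ?thesis using ss by auto
    next
      case 3
      show ?thesis
      proof (cases "y = 1")
        case True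
        then have "x + k = 3" "1 \<le> x" using xy 3 by linarith+
        then have "x = 3 \<and> k = 0 \<or> x = 2 \<and> k = 1 \<or> x = 1 \<and> k = 2" by presburger
        then show ?thesis using ss True by auto
      next
        case False
        then have "x = 2 \<and> y = 2 \<and> k = 0" using xy 3 by linarith
        then show ?thesis using ss by simp
      qed
    next
      case 4
      \<comment> \<open>The only place where the gain 7/55 decides: for n = 8 and q = 2 the bound is
        9.9 without it, below the required 10.067, and one branch with two leaves lifts it
        above.\<close>
      have "x < 2"
      proof (rule ccontr)
        assume "\<not> x < 2"
        then have "1 \<le> t" using t by simp
        then show False using bad ss 4 by simp
      qed
      then have "x = 1 \<and> y = 1 \<and> k = 3" using xy 4 by linarith
      then show ?thesis using ss by auto
    qed (use bad ss in simp_all)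
  next
    case 2
    then obtain x y z where ss: "ss = [x, y, z]"
      by (auto simp: q_def eval_nat_numeral length_Suc_conv)
    then have xyz: "y \<le> x" "z \<le> y" "1 \<le> z" "n = 4 + k + x + y + z" using sorted pos n by auto
    show ?thesis
      using n_cases
    proof cases
      case 3
      then have "x = 1 \<and> y = 1 \<and> z = 1 \<and> k = 0" using xyz by linarith
      then show ?thesis using ss by simp
    next
      case 4
      then have "y = 1" "z = 1" "x + k = 2" "1 \<le> x" using xyz by linarith+
      moreover from this(3,4) have "x = 2 \<and> k = 0 \<or> x = 1 \<and> k = 1" by presburger
      ultimately show ?thesis using ss by auto
    next
      \<comment> \<open>A narrow case: 11.378 against 11.355. Without the correction - 1 / n in the
        bound for the path the comparison would fail here when t = 0.\<close>
      case 5
      then show ?thesis using bad ss by simp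
    next
      case 6
      then show ?thesis using bad ss by simp
    qed (use xyz in linarith)+
  next
    case 3
    then obtain x y z w where ss: "ss = [x, y, z, w]"
      by (auto simp: q_def eval_nat_numeral length_Suc_conv)
    then have xyz: "y \<le> x" "z \<le> y" "w \<le> z" "1 \<le> w" "n = 5 + k + x + y + z + w"
      using sorted pos n by auto
    show ?thesis
      using n_cases
    proof cases
      case 5
      then have "x = 1 \<and> y = 1 \<and> z = 1 \<and> w = 1 \<and> k = 0" using xyz by linarith
      then show ?thesis using ss by simp
    next
      case 6
      then show ?thesis using bad ss by simp
    qed (use xyz in linarith)+
  qed
qed

context two_level_tree
begin

text \<open>The equality case, settled by listing the vertices along the path: leaf, branch vertex,
  centre, branch vertex, leaf.\<close>

lemma laplacian_energy_eq_path_graph_5: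
  assumes "has_branches [1, 1] 0"
  shows "laplacian_energy G = laplacian_energy (path_graph 5)"
proof -
  obtain x y where xy: "x \<noteq> y" "{x, y} \<subseteq> C" "card (C - {x, y}) = 0" "s x = 1" "s y = 1"
    using assms unfolding has_branches_def by (auto simp: map_eq_Cons_conv)
  obtain u v where L: "L x = {u}" "L y = {v}"
    using xy by (meson card_1_singletonE)
  have "C - {x, y} = {}" using xy(3) finite_C by (metis card_0_eq finite_Diff)
  then have C: "C = {x, y}" using xy(2) by blast
  have dist: "u \<noteq> x" "u \<noteq> c" "u \<noteq> y" "u \<noteq> v" "x \<noteq> c" "v \<noteq> x" "c \<noteq> y" "v \<noteq> c" "v \<noteq> y"
    using L C c_notin_C c_notin_L[of x] c_notin_L[of y] L_disjoint_C[of x] L_disjoint_C[of y]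
      L_disjoint[of x y] xy(1) by auto
  note dist' = dist xy(1) dist[symmetric] xy(1)[symmetric]
  let ?zs = "[u, x, c, y, v]"
  have arcs': "\<forall>i\<in>{0, 1, 2, 3, 4}. \<forall>j\<in>{0, 1, 2, 3, 4}.
      (?zs ! i, ?zs ! j) \<in> parcs G \<longleftrightarrow> (i, j) \<in> parcs (path_graph 5)"
    unfolding arcs by (simp add: C L dist' path_graph_def)
  show ?thesis
  proof (rule laplacian_energy_cong[OF graph pair_graph_path_graph])
    show "distinct ?zs" "set ?zs = pverts G" using dist' L by (auto simp: verts C)
    show "distinct [0..<5]" "set [0..<5] = pverts (path_graph 5)" "length ?zs = length [0..<5]"
      by (auto simp: path_graph_def)
    fix i j assume "i < length ?zs" "j < length ?zs"
    then have "i \<in> {0, 1, 2, 3, 4}" "j \<in> {0, 1, 2, 3, 4}" by auto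
    then have "(?zs ! i, ?zs ! j) \<in> parcs G \<longleftrightarrow> (i, j) \<in> parcs (path_graph 5)"
      using arcs' by blast
    moreover have "[0..<5] ! i = i" "[0..<5] ! j = j"
      using \<open>i < length ?zs\<close> \<open>j < length ?zs\<close> by (simp_all del: upt_Suc)
    ultimately show "(?zs ! i, ?zs ! j) \<in> parcs G \<longleftrightarrow> ([0..<5] ! i, [0..<5] ! j) \<in> parcs (path_graph 5)"
      by (simp only:)
  qed
qed

end

lemma (in two_level_tree) laplacian_energy_path_graph_le_energy:
  assumes ab: "a \<in> C" "b \<in> C" "a \<noteq> b" "L a \<noteq> {}" "L b \<noteq> {}"
  shows "laplacian_energy (path_graph (card (pverts G))) \<le> laplacian_energy G"
proof -
  define n where "n = card (pverts G)"
  obtain ss k where br: "has_branches ss k" and ss: "sorted_wrt (\<ge>) ss" "\<forall>m\<in>set ss. 1 \<le> m" "2 \<le> length ss"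
    and q: "length ss = card {x \<in> C. 1 \<le> s x}"
    and t: "length (filter (\<lambda>m. 2 \<le> m) ss) = card {x \<in> C. 2 \<le> s x}"
    using branches_exist[OF ab] .
  have n: "n = 1 + length ss + k + sum_list ss"
    using card_verts_branches[OF br] by (simp add: n_def)
  have "laplacian_energy (path_graph n) \<le> laplacian_energy G"
  proof (cases "(ss, k) = ([1, 1], 0)")
    case True
    then have "laplacian_energy G = laplacian_energy (path_graph 5)"
      using br laplacian_energy_eq_path_graph_5 by simp
    moreover have "n = 5" using n True by simp
    ultimately show ?thesis by (simp only: order_refl)
  next
    case False
    have "length ss \<le> sum_list ss"
      using ss(2) by (induction ss) auto
    then have "laplacian_energy (path_graph n) \<le> 637 / 500 * real n - 1 / real n"
      using ss(3) n by (intro laplacian_energy_path_graph_le) simp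
    also have "\<dots> \<le> laplacian_energy G"
    proof (cases "637 / 500 * real n - 1 / real n \<le> 2 * (real n - 3 - 2 / 5 * real (length ss)
        + 7 / 55 * real (length (filter (\<lambda>m. 2 \<le> m) ss)) + 2 * real (length ss + 1) / real n)")
      case True
      then show ?thesis
        using laplacian_energy_ge_count unfolding q[symmetric] t[symmetric] n_def[symmetric]
        by (rule order_trans)
    next
      case bad: False
      have "(ss, k) \<in> {([2, 1], 0), ([1, 1], 1), ([3, 1], 0), ([2, 2], 0),
          ([1, 1, 1], 0), ([2, 1], 1), ([1, 1], 2), ([2, 1, 1], 0), ([1, 1, 1], 1), ([1, 1], 3), ([1, 1, 1, 1], 0)}"
        using branch_count_bound[OF ss n refl] bad False by (simp only: not_le insert_iff simp_thms)
      then show ?thesis using laplacian_energy_ge_exceptional[OF br] by (simp add: n_def)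
    qed
    finally show ?thesis .
  qed
  then show ?thesis by (simp add: n_def)
qed

theorem theorem4p2:
  fixes T :: "'a pair_pre_digraph" and n :: nat
  assumes "tree_graph T"
    and "card (pverts T) = n"
    and "graph_diameter T = 4"
  shows "laplacian_energy (path_graph n) \<le> laplacian_energy T"
proof -
  obtain c C L a b where T: "two_level_tree T c C L"
    and ab: "a \<in> C" "b \<in> C" "a \<noteq> b" "L a \<noteq> {}" "L b \<noteq> {}"
    using diameter_four_two_level_tree[OF assms(1,3)] .
  show ?thesis
    using two_level_tree.laplacian_energy_path_graph_le_energy[OF T ab] assms(2) by simp
qed

end
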